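(* Let $(W,S)$ be a Coxeter system of type $\Lambda$ and let $\alpha$ be a reduced expression. Then the braid graph $\mathcal{B}(\alpha)$ is a partial cube and its isometric dimension satisfies $\dim_I(\mathcal{B}(\alpha))=\dim(\alpha)$.
   Context: A Coxeter system $(W,S)$ consists of a finite set $S$ and the group $W=\langle S\mid (st)^{m(s,t)}=e\rangle$, where $m(s,s)=1$ and $m(s,t)=m(t,s)\in\{2,3,\dots\}\cup\{\infty\}$ for $s\neq t$ ($m(s,t)=\infty$ means no relation). Its Coxeter graph has vertex set $S$ and an edge $\{s,t\}$ whenever $m(s,t)\ge 3$. $(W,S)$ is of type $\Lambda$ if $m(s,t)\le 3$ for all $s,t\in S$ (simply laced) and the Coxeter graph contains no three-cycles (triangle free). A reduced expression for $w\in W$ is a word over $S$ of minimal length representing $w$. A braid move replaces three consecutive letters $sts$ by $tst$, where $m(s,t)=3$. Two reduced expressions are braid equivalent if they are related by a finite sequence of braid moves; $[\alpha]$ denotes the braid class (equivalence class) of $\alpha$. The braid graph $\mathcal{B}(\alpha)$ has vertex set $[\alpha]$, with two vertices adjacent if and only if they are related by a single braid move. A braid shadow for a reduced expression $\alpha$ is a set of positions $\{i-1,i,i+1\}$ such that the letters of $\alpha$ in these positions form $sts$ with $m(s,t)=3$. $\mathcal{S}(\alpha)$ is the set of braid shadows for $\alpha$, and $\mathcal{S}([\alpha])=\bigcup_{\beta\in[\alpha]}\mathcal{S}(\beta)$. The dimension of $\alpha$ is $\dim(\alpha)=|\mathcal{S}([\alpha])|$. The hypercube $Q_n$ ($n\ge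 0$) has vertex set $\{0,1\}^n$, with two vertices adjacent when they differ in exactly one digit. An isometric embedding $f:G\to H$ is a map $V(G)\to V(H)$ preserving path distances. A (connected) graph $G$ is a partial cube if it can be isometrically embedded in some $Q_n$; its isometric dimension $\dim_I(G)$ is the least such $n$. *)

theory Defs
  imports
    "HOL-Algebra.Group"
    "HOL-Library.Extended_Nat"
    "Graph_Theory.Graph_Theory"
begin

section \<open>Groups given by generators and relations\<close>

text \<open>
  Words in the generators \<open>X\<close> and their formal inverses: the letter \<open>(x, True)\<close> stands for \<open>x\<close>
  and \<open>(x, False)\<close> for the inverse of \<open>x\<close>.
\<close>

type_synonym 'a signed_word = "('a \<times> bool) list"

definition signed_words :: "'a set \<Rightarrow> 'a signed_word set" where
  "signed_words X = lists (X \<times> UNIV)"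

text \<open>
  The smallest congruence on words that makes \<open>x\<close> and its formal inverse cancel and every relator
  in \<open>R\<close> trivial. Its quotient is the free group on \<open>X\<close> modulo the normal closure of \<open>R\<close>.
\<close>

inductive presentation_eq :: "'a set \<Rightarrow> 'a signed_word set \<Rightarrow> 'a signed_word \<Rightarrow> 'a signed_word \<Rightarrow> bool"
  for X R where
    refl: "u \<in> signed_words X \<Longrightarrow> presentation_eq X R u u"
  | sym: "presentation_eq X R u v \<Longrightarrow> presentation_eq X R v u"
  | trans: "presentation_eq X R u v \<Longrightarrow> presentation_eq X R v w \<Longrightarrow> presentation_eq X R u w"
  | cancel: "u \<in> signed_words X \<Longrightarrow> v \<in> signed_words X \<Longrightarrow> x \<in> X \<Longrightarrow>
      presentation_eq X R (u @ [(x, b), (x, \<not> b)] @ v) (u @ v)"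
  | relator: "u \<in> signed_words X \<Longrightarrow> v \<in> signed_words X \<Longrightarrow> r \<in> R \<Longrightarrow> r \<in> signed_words X \<Longrightarrow>
      presentation_eq X R (u @ r @ v) (u @ v)"

definition presentation_rel :: "'a set \<Rightarrow> 'a signed_word set \<Rightarrow> 'a signed_word rel" where
  "presentation_rel X R = {(u, v). presentation_eq X R u v}"

definition presented_group :: "'a set \<Rightarrow> 'a signed_word set \<Rightarrow> 'a signed_word set monoid" where
  "presented_group X R =
     \<lparr> carrier = signed_words X // presentation_rel X R,
       monoid.mult = (\<lambda>A B. \<Union>u\<in>A. \<Union>v\<in>B. presentation_rel X R `` {u @ v}),
       one = presentation_rel X R `` {[]} \<rparr>"

lemma presentation_eq_words:
  assumes "presentation_eq X R u v"
  shows "u \<in> signed_words X \<and> v \<in> signed_words X"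
  using assms by induction (auto simp: signed_words_def)

lemma presentation_eq_append_left:
  assumes "presentation_eq X R u v" "w \<in> signed_words X"
  shows "presentation_eq X R (w @ u) (w @ v)"
  using assms
proof (induction rule: presentation_eq.induct)
  case (refl u)
  then show ?case by (auto intro: presentation_eq.refl simp: signed_words_def)
next
  case (sym u v)
  then show ?case by (auto intro: presentation_eq.sym)
next
  case (trans u v w)
  then show ?case by (meson presentation_eq.trans)
next
  case (cancel u v x b)
  then have "w @ u \<in> signed_words X" by (auto simp: signed_words_def)
  from presentation_eq.cancel[OF this cancel(2,3), of R b] show ?case by simp
next
  case (relator u v r)
  then have "w @ u \<in> signed_words X" by (auto simp: signed_words_def)
  from presentation_eq.relator[OF this relator(2,3,4)] show ?case by simp
qed

lemma presentation_eq_append_right: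
  assumes "presentation_eq X R u v" "w \<in> signed_words X"
  shows "presentation_eq X R (u @ w) (v @ w)"
  using assms
proof (induction rule: presentation_eq.induct)
  case (refl u)
  then show ?case by (auto intro: presentation_eq.refl simp: signed_words_def)
next
  case (sym u v)
  then show ?case by (auto intro: presentation_eq.sym)
next
  case (trans u v w)
  then show ?case by (meson presentation_eq.trans)
next
  case (cancel u v x b)
  then have "v @ w \<in> signed_words X" by (auto simp: signed_words_def)
  from presentation_eq.cancel[OF cancel(1) this cancel(3), of R b] show ?case by simp
next
  case (relator u v r)
  then have "v @ w \<in> signed_words X" by (auto simp: signed_words_def)
  from presentation_eq.relator[OF relator(1) this relator(3,4)] show ?case by simp
qed

lemma equiv_presentation_rel: "equiv (signed_words X) (presentation_rel X R)"
proof (rule equivI)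
  show "presentation_rel X R \<subseteq> signed_words X \<times> signed_words X"
    using presentation_eq_words by (fastforce simp: presentation_rel_def)
  show "refl_on (signed_words X) (presentation_rel X R)"
    by (auto simp: refl_on_def presentation_rel_def intro: presentation_eq.refl)
  show "Relation.sym (presentation_rel X R)"
    by (auto simp: sym_def presentation_rel_def intro: presentation_eq.sym)
  show "Relation.trans (presentation_rel X R)"
    by (auto simp: trans_def presentation_rel_def intro: presentation_eq.trans)
qed

lemma presented_group_mult:
  assumes "u \<in> signed_words X" "v \<in> signed_words X"
  shows "presentation_rel X R `` {u} \<otimes>\<^bsub>presented_group X R\<^esub> presentation_rel X R `` {v}
    = presentation_rel X R `` {u @ v}"
proof -
  let ?E = "presentation_rel X R"
  have "congruent2 ?E ?E (\<lambda>u v. ?E `` {u @ v})"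
  proof (rule congruent2I[OF equiv_presentation_rel equiv_presentation_rel])
    fix y z w assume w: "w \<in> signed_words X" and yz: "(y, z) \<in> ?E"
    have "(y @ w, z @ w) \<in> ?E"
      using presentation_eq_append_right yz w by (auto simp: presentation_rel_def)
    then show "?E `` {y @ w} = ?E `` {z @ w}" by (rule equiv_class_eq[OF equiv_presentation_rel])
    have "(w @ y, w @ z) \<in> ?E"
      using presentation_eq_append_left yz w by (auto simp: presentation_rel_def)
    then show "?E `` {w @ y} = ?E `` {w @ z}" by (rule equiv_class_eq[OF equiv_presentation_rel])
  qed
  from UN_equiv_class2[OF equiv_presentation_rel equiv_presentation_rel this assms]
  show ?thesis by (simp add: presented_group_def)
qed

lemma presentation_eq_inverse:
  assumes "u \<in> signed_words X"
  shows "presentation_eq X R (rev (map (\<lambda>(x, b). (x, \<not> b)) u) @ u) []"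
  using assms
proof (induction u)
  case Nil
  then show ?case by (auto intro: presentation_eq.refl simp: signed_words_def)
next
  case (Cons a u)
  obtain x b where a: "a = (x, b)" by force
  let ?i = "rev (map (\<lambda>(x, b). (x, \<not> b)) u)"
  have *: "x \<in> X" "u \<in> signed_words X" "?i \<in> signed_words X"
    using Cons.prems a by (auto simp: signed_words_def)
  have "presentation_eq X R (?i @ [(x, \<not> b), (x, \<not> \<not> b)] @ u) (?i @ u)"
    by (rule presentation_eq.cancel) (use * in auto)
  then show ?case
    using Cons.IH * by (auto simp: a intro: presentation_eq.trans)
qed

lemma group_presented_group: "group (presented_group X R)"
proof (rule groupI)
  let ?G = "presented_group X R" and ?E = "presentation_rel X R"
  have carr: "carrier ?G = signed_words X // ?E" and one: "\<one>\<^bsub>?G\<^esub> = ?E `` {[]}"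
    by (simp_all add: presented_group_def)
  have nil: "[] \<in> signed_words X" by (simp add: signed_words_def)
  have app: "u @ v \<in> signed_words X" if "u \<in> signed_words X" "v \<in> signed_words X" for u v
    using that by (auto simp: signed_words_def)
  show "\<one>\<^bsub>?G\<^esub> \<in> carrier ?G" using nil by (auto simp: carr one intro: quotientI)
  fix A assume "A \<in> carrier ?G"
  then obtain u where u: "u \<in> signed_words X" "A = ?E `` {u}" by (auto simp: carr elim: quotientE)
  show "\<one>\<^bsub>?G\<^esub> \<otimes>\<^bsub>?G\<^esub> A = A" using u nil by (simp add: one presented_group_mult)
  let ?i = "rev (map (\<lambda>(x, b). (x, \<not> b)) u)"
  have i: "?i \<in> signed_words X" using u by (auto simp: signed_words_def)
  have "?E `` {?i} \<otimes>\<^bsub>?G\<^esub> A = ?E `` {?i @ u}" using u i by (simp add: presented_group_mult)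
  also have "\<dots> = ?E `` {[]}"
    by (rule equiv_class_eq[OF equiv_presentation_rel])
      (use presentation_eq_inverse[OF u(1)] in \<open>auto simp: presentation_rel_def\<close>)
  finally show "\<exists>B\<in>carrier ?G. B \<otimes>\<^bsub>?G\<^esub> A = \<one>\<^bsub>?G\<^esub>"
    using i by (auto simp: carr one intro: quotientI)
  fix B assume "B \<in> carrier ?G"
  then obtain v where v: "v \<in> signed_words X" "B = ?E `` {v}" by (auto simp: carr elim: quotientE)
  show "A \<otimes>\<^bsub>?G\<^esub> B \<in> carrier ?G"
    using u v app by (auto simp: presented_group_mult carr intro: quotientI)
  fix C assume "C \<in> carrier ?G"
  then obtain w where w: "w \<in> signed_words X" "C = ?E `` {w}" by (auto simp: carr elim: quotientE)
  show "(A \<otimes>\<^bsub>?G\<^esub> B) \<otimes>\<^bsub>?G\<^esub> C = A \<otimes>\<^bsub>?G\<^esub> (B \<otimes>\<^bsub>?G\<^esub> C)"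
    using u v w app by (simp add: presented_group_mult)
qed

section \<open>Coxeter systems\<close>

definition coxeter_matrix :: "'a set \<Rightarrow> ('a \<Rightarrow> 'a \<Rightarrow> enat) \<Rightarrow> bool" where
  "coxeter_matrix S m \<longleftrightarrow> finite S \<and> (\<forall>s\<in>S. m s s = 1) \<and>
     (\<forall>s\<in>S. \<forall>t\<in>S. m s t = m t s) \<and> (\<forall>s\<in>S. \<forall>t\<in>S. s \<noteq> t \<longrightarrow> m s t \<ge> 2)"

definition coxeter_relators :: "'a set \<Rightarrow> ('a \<Rightarrow> 'a \<Rightarrow> enat) \<Rightarrow> 'a signed_word set" where
  "coxeter_relators S m =
     {concat (replicate k [(s, True), (t, True)]) | s t k. s \<in> S \<and> t \<in> S \<and> m s t = enat k}"

definition coxeter_group :: "'a set \<Rightarrow> ('a \<Rightarrow> 'a \<Rightarrow> enat) \<Rightarrow> 'a signed_word set monoid" where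
  "coxeter_group S m = presented_group S (coxeter_relators S m)"

definition coxeter_generator :: "'a set \<Rightarrow> ('a \<Rightarrow> 'a \<Rightarrow> enat) \<Rightarrow> 'a \<Rightarrow> 'a signed_word set" where
  "coxeter_generator S m s = presentation_rel S (coxeter_relators S m) `` {[(s, True)]}"

definition coxeter_graph :: "'a set \<Rightarrow> ('a \<Rightarrow> 'a \<Rightarrow> enat) \<Rightarrow> 'a pair_pre_digraph" where
  "coxeter_graph S m = \<lparr> pverts = S, parcs = {(s, t). s \<in> S \<and> t \<in> S \<and> m s t \<ge> 3} \<rparr>"

definition type_Lambda :: "'a set \<Rightarrow> ('a \<Rightarrow> 'a \<Rightarrow> enat) \<Rightarrow> bool" where
  "type_Lambda S m \<longleftrightarrow> (\<forall>s\<in>S. \<forall>t\<in>S. m s t \<le> 3) \<and>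
     (\<nexists>p. pre_digraph.cycle (with_proj (coxeter_graph S m)) p \<and> length p = 3)"

definition word_value :: "'a set \<Rightarrow> ('a \<Rightarrow> 'a \<Rightarrow> enat) \<Rightarrow> 'a list \<Rightarrow> 'a signed_word set" where
  "word_value S m \<alpha> =
     foldr (\<lambda>s g. coxeter_generator S m s \<otimes>\<^bsub>coxeter_group S m\<^esub> g) \<alpha> \<one>\<^bsub>coxeter_group S m\<^esub>"

definition reduced_expression ::
  "'a set \<Rightarrow> ('a \<Rightarrow> 'a \<Rightarrow> enat) \<Rightarrow> 'a signed_word set \<Rightarrow> 'a list \<Rightarrow> bool" where
  "reduced_expression S m w \<alpha> \<longleftrightarrow> \<alpha> \<in> lists S \<and> word_value S m \<alpha> = w \<and>
     (\<forall>\<beta>\<in>lists S. word_value S m \<beta> = w \<longrightarrow> length \<alpha> \<le> length \<beta>)"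

section \<open>Braid classes, braid graphs and braid shadows\<close>

inductive braid_move :: "'a set \<Rightarrow> ('a \<Rightarrow> 'a \<Rightarrow> enat) \<Rightarrow> 'a list \<Rightarrow> 'a list \<Rightarrow> bool"
  for S m where
    "s \<in> S \<Longrightarrow> t \<in> S \<Longrightarrow> m s t = 3 \<Longrightarrow> braid_move S m (u @ [s, t, s] @ v) (u @ [t, s, t] @ v)"

text \<open>
  Braid moves change neither the length nor the group element of a word, so the class of a reduced
  expression consists of reduced expressions only.
\<close>

definition braid_class :: "'a set \<Rightarrow> ('a \<Rightarrow> 'a \<Rightarrow> enat) \<Rightarrow> 'a list \<Rightarrow> 'a list set" where
  "braid_class S m \<alpha> = {\<beta>. (braid_move S m)\<^sup>*\<^sup>* \<alpha> \<beta>}"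

definition braid_graph :: "'a set \<Rightarrow> ('a \<Rightarrow> 'a \<Rightarrow> enat) \<Rightarrow> 'a list \<Rightarrow> 'a list pair_pre_digraph" where
  "braid_graph S m \<alpha> =
     \<lparr> pverts = braid_class S m \<alpha>,
       parcs = {(\<beta>, \<gamma>). \<beta> \<in> braid_class S m \<alpha> \<and> \<gamma> \<in> braid_class S m \<alpha> \<and> braid_move S m \<beta> \<gamma>} \<rparr>"

text \<open>Positions are counted from \<open>0\<close>, as usual for lists.\<close>

definition braid_shadows :: "'a set \<Rightarrow> ('a \<Rightarrow> 'a \<Rightarrow> enat) \<Rightarrow> 'a list \<Rightarrow> nat set set" where
  "braid_shadows S m \<alpha> =
     {{i - 1, i, i + 1} | i. 1 \<le> i \<and> i + 1 < length \<alpha> \<and>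
        (\<exists>s\<in>S. \<exists>t\<in>S. m s t = 3 \<and> \<alpha> ! (i - 1) = s \<and> \<alpha> ! i = t \<and> \<alpha> ! (i + 1) = s)}"

definition class_braid_shadows :: "'a set \<Rightarrow> ('a \<Rightarrow> 'a \<Rightarrow> enat) \<Rightarrow> 'a list \<Rightarrow> nat set set" where
  "class_braid_shadows S m \<alpha> = (\<Union>\<beta>\<in>braid_class S m \<alpha>. braid_shadows S m \<beta>)"

definition braid_dim :: "'a set \<Rightarrow> ('a \<Rightarrow> 'a \<Rightarrow> enat) \<Rightarrow> 'a list \<Rightarrow> nat" where
  "braid_dim S m \<alpha> = card (class_braid_shadows S m \<alpha>)"

lemma braid_move_sym:
  assumes "coxeter_matrix S m" "braid_move S m \<beta> \<gamma>"
  shows "braid_move S m \<gamma> \<beta>"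
  using assms(2)
proof cases
  case (1 s t u v)
  then have "m t s = 3" using assms(1) by (simp add: coxeter_matrix_def)
  with 1 braid_move.intros[of t S s m u v] show ?thesis by simp
qed

lemma braid_move_neq:
  assumes "coxeter_matrix S m" "braid_move S m \<beta> \<gamma>"
  shows "\<beta> \<noteq> \<gamma>"
  using assms(2)
proof cases
  case (1 s t u v)
  have "s \<noteq> t"
  proof
    assume "s = t"
    with 1(5) have "m s s = 3" by simp
    moreover have "m s s = 1" using assms(1) 1(3) by (simp add: coxeter_matrix_def)
    ultimately show False by (simp add: one_enat_def numeral_eq_enat)
  qed
  then show ?thesis unfolding 1(1,2) by simp
qed

lemma braid_graph_bidirected:
  assumes "coxeter_matrix S m"
  shows "pair_bidirected_digraph (braid_graph S m \<alpha>)"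
proof
  fix e assume e: "e \<in> parcs (braid_graph S m \<alpha>)"
  then show "fst e \<in> pverts (braid_graph S m \<alpha>)" "snd e \<in> pverts (braid_graph S m \<alpha>)"
    by (auto simp: braid_graph_def)
  show "fst e \<noteq> snd e"
    using e braid_move_neq[OF assms] by (cases e) (simp add: braid_graph_def)
next
  show "symmetric (with_proj (braid_graph S m \<alpha>))"
    using braid_move_sym[OF assms] by (auto simp: symmetric_def sym_def braid_graph_def)
qed

section \<open>Partial cubes\<close>

text \<open>
  Undirected graphs are symmetric digraphs. Path distance is the library's \<open>\<mu>\<close> with every arc
  of weight \<open>1\<close>; it is \<open>\<infinity>\<close> between different components.
\<close>

definition graph_dist :: "'v pair_pre_digraph \<Rightarrow> 'v \<Rightarrow> 'v \<Rightarrow> ereal" where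
  "graph_dist G = wf_digraph.\<mu> (with_proj G) (\<lambda>_. 1)"

definition hypercube :: "nat \<Rightarrow> bool list pair_pre_digraph" where
  "hypercube n =
     \<lparr> pverts = {x. length x = n},
       parcs = {(x, y). length x = n \<and> length y = n \<and> card {i. i < n \<and> x ! i \<noteq> y ! i} = 1} \<rparr>"

definition isometric_embedding ::
  "'v pair_pre_digraph \<Rightarrow> 'w pair_pre_digraph \<Rightarrow> ('v \<Rightarrow> 'w) \<Rightarrow> bool" where
  "isometric_embedding G H f \<longleftrightarrow> f ` pverts G \<subseteq> pverts H \<and>
     (\<forall>u\<in>pverts G. \<forall>v\<in>pverts G. graph_dist H (f u) (f v) = graph_dist G u v)"

definition partial_cube :: "'v pair_pre_digraph \<Rightarrow> bool" where
  "partial_cube G \<longleftrightarrow> Digraph_Component.connected (with_proj G) \<and>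
     (\<exists>n f. isometric_embedding G (hypercube n) f)"

definition isometric_dim :: "'v pair_pre_digraph \<Rightarrow> nat" where
  "isometric_dim G = (LEAST n. \<exists>f. isometric_embedding G (hypercube n) f)"

end

theory Submission
  imports Defs
begin

text \<open>
  Call a position a centre if some word of the braid class can be braided around it, so that
  \<open>dim(\<alpha>)\<close> is the number of centres. The claim follows once path distance in the braid graph is
  shown to be the number of centres at which two words carry different letters: recording at each
  centre whether the letter differs from that of \<open>\<alpha>\<close> is then an isometric embedding into the
  hypercube of dimension \<open>dim(\<alpha>)\<close>. No smaller hypercube will do, because every centre is the
  direction of some edge, and whether two edges have the same direction can be read off from distances
  (\<open>isometric_embedding_dim_le\<close>).

  Two facts about the words of the class are needed. Since \<open>stst = ts\<close> in the group when
  \<open>m(s,t) = 3\<close>, no word contains a factor \<open>stst\<close> of that kind; and the letters related by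
  \<open>m = 3\<close> form a triangle-free graph. Their consequences:

  \<^item> Two centres are never adjacent positions (\<open>centres_not_adjacent\<close>). Hence only moves around a
    centre \<open>c\<close> change the letter at \<open>c\<close>, and each move changes the letter at exactly one centre.

  \<^item> At a centre only two letters occur, and they are related (\<open>letters_eq\<close>). A third letter could
    arrive only from a neighbouring centre two positions away, and would close a triangle.

  \<^item> Neighbouring centres \<open>c\<close> and \<open>c + 2\<close> have different letter pairs \<open>{s, t}\<close> and \<open>{t, u}\<close>
    (\<open>letters_neq\<close>). The three letters from \<open>c\<close> to \<open>c + 2\<close> are always \<open>stu\<close>, \<open>tsu\<close> or \<open>sut\<close>:
    everything except the letter \<open>t\<close> at both centres is possible.

  So a word amounts to a choice of one of two letters at each centre, where between neighbouring
  centres one of the four combinations is forbidden. Suppose that two such words differ. A centre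
  where they differ can be flipped towards the target unless the forbidden combination with a neighbour
  prevents it; then the words differ at that neighbour too, and it is not blocked from the first centre
  in turn (\<open>blocked_by_next_centre\<close>). Following the blockages in one direction ends at a centre where
  a braid move brings the first word closer to the second (\<open>shadow_towards\<close>).
\<close>

section \<open>Path distance and isometric embeddings into hypercubes\<close>

text \<open>
  Path distance is the only function that vanishes on the diagonal, drops by at most one along
  an arc, and can always be decreased along some arc: the second property bounds the length
  of every walk from below, the third builds a walk that attains the bound.
\<close>

lemma graph_dist_eqI:
  fixes \<delta> :: "'v \<Rightarrow> 'v \<Rightarrow> nat"
  assumes wf: "wf_digraph (with_proj G)"
    and diag: "\<And>v. \<delta> v v = 0"
    and step: "\<And>u u' v. (u, u') \<in> parcs G \<Longrightarrow> \<delta> u v \<le> Suc (\<delta> u' v)"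
    and approach: "\<And>u v. u \<in> pverts G \<Longrightarrow> v \<in> pverts G \<Longrightarrow> u \<noteq> v \<Longrightarrow>
      \<exists>u'. (u, u') \<in> parcs G \<and> \<delta> u' v < \<delta> u v"
    and uv: "u \<in> pverts G" "v \<in> pverts G"
  shows "graph_dist G u v = ereal (real (\<delta> u v))"
    and "u \<rightarrow>\<^sup>*\<^bsub>with_proj G\<^esub> v"
proof -
  interpret wf_digraph "with_proj G" by (rule wf)
  have cost: "awalk_cost (\<lambda>_. 1) p = real (length p)" for p
    by (induction p) auto
  have lower: "\<delta> u v \<le> length p" if "awalk u p v" for u p
    using that
  proof (induction p arbitrary: u)
    case Nil
    then show ?case by (simp add: awalk_Nil_iff diag)
  next
    case (Cons e p)
    then have "(u, snd e) \<in> parcs G" "awalk (snd e) p v"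
      by (auto simp: awalk_Cons_iff)
    then show ?case using step[of u "snd e" v] Cons.IH[of "snd e"] by simp
  qed
  have upper: "\<exists>p. awalk u p v \<and> length p \<le> \<delta> u v" if "u \<in> pverts G" for u
    using that
  proof (induction "\<delta> u v" arbitrary: u rule: less_induct)
    case less
    show ?case
    proof (cases "u = v")
      case True
      then show ?thesis using less.prems by (intro exI[of _ "[]"]) (simp add: awalk_Nil_iff)
    next
      case False
      then obtain u' where u': "(u, u') \<in> parcs G" "\<delta> u' v < \<delta> u v"
        using approach less.prems uv(2) by blast
      then have "u' \<in> pverts G" using head_in_verts[of "(u, u')"] by simp
      then obtain p where "awalk u' p v" "length p \<le> \<delta> u' v" using less.hyps u'(2) by blast
      then show ?thesis using u' by (intro exI[of _ "(u, u') # p"]) (auto simp: awalk_Cons_iff)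
    qed
  qed
  obtain p where p: "awalk u p v" "length p \<le> \<delta> u v" using upper[OF uv(1)] by blast
  show "u \<rightarrow>\<^sup>*\<^bsub>with_proj G\<^esub> v" using p(1) by (auto simp: reachable_awalk)
  have "\<mu> (\<lambda>_. 1) u v \<le> ereal (real (\<delta> u v))"
    using min_cost_le_walk_cost[OF p(1), of "\<lambda>_. 1"] p(2)
    by (auto simp: cost intro: order_trans)
  moreover have "ereal (real (\<delta> u v)) \<le> \<mu> (\<lambda>_. 1) u v"
    unfolding \<mu>_def by (rule INF_greatest) (auto simp: cost lower)
  ultimately show "graph_dist G u v = ereal (real (\<delta> u v))"
    unfolding graph_dist_def by (rule antisym)
qed

definition hamming :: "nat \<Rightarrow> bool list \<Rightarrow> bool list \<Rightarrow> nat" where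
  "hamming n x y = card {i. i < n \<and> x ! i \<noteq> y ! i}"

lemma hamming_eq_sum: "int (hamming n x y) = (\<Sum>i<n. if x ! i \<noteq> y ! i then 1 else 0)"
proof -
  have "{i. i < n \<and> x ! i \<noteq> y ! i} = {i \<in> {..<n}. x ! i \<noteq> y ! i}" by auto
  then show ?thesis by (simp add: hamming_def sum.If_cases Int_def)
qed

lemma hamming_triangle: "hamming n x z \<le> hamming n x y + hamming n y z"
proof -
  have "int (hamming n x z) \<le> int (hamming n x y) + int (hamming n y z)"
    unfolding hamming_eq_sum sum.distrib[symmetric] by (rule sum_mono) auto
  then show ?thesis by simp
qed

lemma graph_dist_hypercube:
  assumes "length x = n" "length y = n"
  shows "graph_dist (hypercube n) x y = ereal (real (hamming n x y))"
proof (rule graph_dist_eqI(1))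
  show "wf_digraph (with_proj (hypercube n))"
    by unfold_locales (auto simp: hypercube_def)
  show "hamming n v v = 0" for v by (simp add: hamming_def)
  show "hamming n u v \<le> Suc (hamming n u' v)" if "(u, u') \<in> parcs (hypercube n)" for u u' v
  proof -
    have "hamming n u u' = 1" using that by (simp add: hypercube_def hamming_def)
    then show ?thesis using hamming_triangle[of n u v u'] by simp
  qed
  show "\<exists>u'. (u, u') \<in> parcs (hypercube n) \<and> hamming n u' v < hamming n u v"
    if uv: "u \<in> pverts (hypercube n)" "v \<in> pverts (hypercube n)" "u \<noteq> v" for u v
  proof -
    from uv obtain i where i: "i < n" "u ! i \<noteq> v ! i" "length u = n" "length v = n"
      by (auto simp: hypercube_def list_eq_iff_nth_eq)
    let ?u = "u[i := v ! i]"
    have "{j. j < n \<and> u ! j \<noteq> ?u ! j} = {i}" using i by (auto simp: nth_list_update)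
    then have "(u, ?u) \<in> parcs (hypercube n)" using i by (simp add: hypercube_def)
    moreover have "hamming n ?u v < hamming n u v"
      unfolding hamming_def by (rule psubset_card_mono) (use i in \<open>auto simp: nth_list_update\<close>)
    ultimately show ?thesis by blast
  qed
  show "x \<in> pverts (hypercube n)" "y \<in> pverts (hypercube n)"
    using assms by (auto simp: hypercube_def)
qed

lemma isometric_embedding_hamming_eq:
  assumes "isometric_embedding G (hypercube k) f" "isometric_embedding G (hypercube n) g"
    and "u \<in> pverts G" "v \<in> pverts G"
  shows "hamming k (f u) (f v) = hamming n (g u) (g v)"
proof -
  have "f w \<in> pverts (hypercube k)" "g w \<in> pverts (hypercube n)" if "w \<in> pverts G" for w
    using assms(1,2) that by (auto simp: isometric_embedding_def)
  then have "length (f w) = k" "length (g w) = n" if "w \<in> pverts G" for w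
    using that by (auto simp: hypercube_def)
  then have "ereal (real (hamming k (f u) (f v))) = graph_dist G u v"
    "ereal (real (hamming n (g u) (g v))) = graph_dist G u v"
    using assms graph_dist_hypercube unfolding isometric_embedding_def by metis+
  then have "ereal (real (hamming k (f u) (f v))) = ereal (real (hamming n (g u) (g v)))"
    by metis
  then show ?thesis by simp
qed

text \<open>
  Djokovic's relation: whether two edges of a hypercube are parallel can be read off from the
  four distances between their ends, since a coordinate contributes to the alternating sum below
  only if both edges change it.
\<close>

lemma hamming_alternating_sum:
  assumes "i < n" "j < n"
    and uv: "\<And>k. k < n \<Longrightarrow> u ! k \<noteq> v ! k \<longleftrightarrow> k = i"
    and xy: "\<And>k. k < n \<Longrightarrow> x ! k \<noteq> y ! k \<longleftrightarrow> k = j"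
  shows "hamming n u x + hamming n v y = hamming n u y + hamming n v x \<longleftrightarrow> i \<noteq> j"
proof -
  let ?d = "\<lambda>x y k. if (x :: bool list) ! k \<noteq> y ! k then 1 else (0 :: int)"
  let ?D = "\<lambda>k. ?d u x k + ?d v y k - (?d u y k + ?d v x k)"
  have "int (hamming n u x + hamming n v y) - int (hamming n u y + hamming n v x) = (\<Sum>k<n. ?D k)"
    by (simp only: of_nat_add hamming_eq_sum sum.distrib sum_subtractf)
  also have "\<dots> = (\<Sum>k<n. if k = i then ?D i else 0)"
    by (rule sum.cong) (use uv in auto)
  also have "\<dots> = ?D i" using assms(1) by simp
  finally have "int (hamming n u x + hamming n v y) - int (hamming n u y + hamming n v x) = ?D i" .
  moreover have "?D i = 0 \<longleftrightarrow> i \<noteq> j" using uv[of i] xy[of i] assms(1) by auto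
  ultimately show ?thesis by linarith
qed

text \<open>
  Parallelism of edges is determined by distances, so if edges of \<open>G\<close> occupy all \<open>k\<close>
  coordinates of one isometric embedding, they occupy \<open>k\<close> distinct coordinates of any other.
\<close>

lemma isometric_embedding_dim_le:
  assumes f: "isometric_embedding G (hypercube k) f"
    and g: "isometric_embedding G (hypercube n) g"
    and edge: "\<And>i. i < k \<Longrightarrow> \<exists>u\<in>pverts G. \<exists>v\<in>pverts G. \<forall>l<k. f u ! l \<noteq> f v ! l \<longleftrightarrow> l = i"
  shows "k \<le> n"
proof -
  have "\<exists>u v. u \<in> pverts G \<and> v \<in> pverts G \<and> (\<forall>l<k. f u ! l \<noteq> f v ! l \<longleftrightarrow> l = i)" if "i < k" for i
    using edge[OF that] by blast
  then obtain U V where UV: "\<And>i. i < k \<Longrightarrow> U i \<in> pverts G \<and> V i \<in> pverts G"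
    "\<And>i l. i < k \<Longrightarrow> l < k \<Longrightarrow> f (U i) ! l \<noteq> f (V i) ! l \<longleftrightarrow> l = i"
    by metis
  note eq = isometric_embedding_hamming_eq[OF f g]
  have "\<exists>j<n. \<forall>l<n. g (U i) ! l \<noteq> g (V i) ! l \<longleftrightarrow> l = j" if i: "i < k" for i
  proof -
    have "{l. l < k \<and> f (U i) ! l \<noteq> f (V i) ! l} = {i}" using UV(2) i by blast
    then have "hamming n (g (U i)) (g (V i)) = 1"
      using eq[of "U i" "V i"] UV(1)[OF i] by (simp add: hamming_def)
    then obtain j where "{l. l < n \<and> g (U i) ! l \<noteq> g (V i) ! l} = {j}"
      unfolding hamming_def by (rule card_1_singletonE)
    then show ?thesis by (auto simp: set_eq_iff)
  qed
  then obtain J where J: "\<And>i. i < k \<Longrightarrow> J i < n"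
    "\<And>i l. i < k \<Longrightarrow> l < n \<Longrightarrow> g (U i) ! l \<noteq> g (V i) ! l \<longleftrightarrow> l = J i"
    by metis
  have "inj_on J {..<k}"
  proof (rule inj_onI)
    fix a b assume ab: "a \<in> {..<k}" "b \<in> {..<k}" "J a = J b"
    then have "a < k" "b < k" by auto
    then have "a \<noteq> b \<longleftrightarrow> J a \<noteq> J b"
      using hamming_alternating_sum[of a k b "f (U a)" "f (V a)" "f (U b)" "f (V b)"]
        hamming_alternating_sum[of "J a" n "J b" "g (U a)" "g (V a)" "g (U b)" "g (V b)"]
        UV J eq by simp
    then show "a = b" using ab(3) by simp
  qed
  then have "card {..<k} \<le> card {..<n}"
    by (rule card_inj_on_le) (use J(1) in auto)
  then show ?thesis by simp
qed

section \<open>Braid moves by position and the class of a word\<close>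

text \<open>
  A shadow is named by its middle position \<open>c\<close>. The relation \<open>A\<close> on letters stands for
  \<open>m(s,t) = 3\<close>; everything about braid moves depends on the Coxeter matrix only through it.
\<close>

definition shadow_at :: "('a \<Rightarrow> 'a \<Rightarrow> bool) \<Rightarrow> nat \<Rightarrow> 'a list \<Rightarrow> bool" where
  "shadow_at A c \<beta> \<longleftrightarrow> 1 \<le> c \<and> c + 1 < length \<beta> \<and> \<beta> ! (c - 1) = \<beta> ! (c + 1) \<and> A (\<beta> ! (c - 1)) (\<beta> ! c)"

definition flip :: "nat \<Rightarrow> 'a list \<Rightarrow> 'a list" where
  "flip c \<beta> = \<beta>[c - 1 := \<beta> ! c, c := \<beta> ! (c - 1), c + 1 := \<beta> ! c]"

definition braid_step :: "('a \<Rightarrow> 'a \<Rightarrow> bool) \<Rightarrow> 'a list \<Rightarrow> 'a list \<Rightarrow> bool" where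
  "braid_step A \<beta> \<gamma> \<longleftrightarrow> (\<exists>c. shadow_at A c \<beta> \<and> \<gamma> = flip c \<beta>)"

definition adjacent :: "nat \<Rightarrow> nat \<Rightarrow> bool" where
  "adjacent p q \<longleftrightarrow> p = Suc q \<or> q = Suc p"

lemma adjacent_sym: "adjacent p q \<longleftrightarrow> adjacent q p"
  by (auto simp: adjacent_def)

lemma length_flip [simp]: "length (flip c \<beta>) = length \<beta>"
  by (simp add: flip_def)

lemma shadow_at_adjacentD:
  assumes "shadow_at A c \<beta>" "adjacent c q"
  shows "\<beta> ! q = \<beta> ! (c - 1)" "A (\<beta> ! q) (\<beta> ! c)"
  using assms by (auto simp: shadow_at_def adjacent_def)

lemma nth_flip:
  assumes "shadow_at A c \<beta>"
  shows "flip c \<beta> ! p = (if p = c then \<beta> ! (c - 1) else if adjacent c p then \<beta> ! c else \<beta> ! p)"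
  using assms by (auto simp: flip_def shadow_at_def adjacent_def nth_list_update)

text \<open>
  The class of a word under braid moves, for a triangle-free relation \<open>A\<close>. Reducedness is replaced
  by a combinatorial property: no word of the class contains a factor \<open>xyxy\<close> with \<open>A x y\<close>.
\<close>

locale braid_words =
  fixes A :: "'a \<Rightarrow> 'a \<Rightarrow> bool" and \<alpha> :: "'a list"
  assumes A_sym: "A x y \<Longrightarrow> A y x"
    and no_triangle: "A x y \<Longrightarrow> A y z \<Longrightarrow> \<not> A x z"
    and no_xyxy: "(braid_step A)\<^sup>*\<^sup>* \<alpha> \<beta> \<Longrightarrow> i + 3 < length \<beta> \<Longrightarrow> A (\<beta> ! i) (\<beta> ! (i + 1)) \<Longrightarrow>
      \<beta> ! (i + 2) = \<beta> ! i \<Longrightarrow> \<beta> ! (i + 3) \<noteq> \<beta> ! (i + 1)"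
begin

text \<open>A loop \<open>A x x\<close> would be a degenerate triangle.\<close>

lemma A_neq: "A x y \<Longrightarrow> x \<noteq> y"
  using no_triangle by blast

definition X :: "'a list set" where
  "X = {\<beta>. (braid_step A)\<^sup>*\<^sup>* \<alpha> \<beta>}"

definition centres :: "nat set" where
  "centres = {c. \<exists>\<beta>\<in>X. shadow_at A c \<beta>}"

definition letters :: "nat \<Rightarrow> 'a set" where
  "letters c = (\<lambda>\<beta>. \<beta> ! c) ` X"

lemma letters_memI: "\<beta> \<in> X \<Longrightarrow> \<beta> ! c \<in> letters c"
  by (simp add: letters_def)

lemma centresI: "\<beta> \<in> X \<Longrightarrow> shadow_at A c \<beta> \<Longrightarrow> c \<in> centres"
  by (auto simp: centres_def)

lemma X_step: "\<beta> \<in> X \<Longrightarrow> braid_step A \<beta> \<gamma> \<Longrightarrow> \<gamma> \<in> X"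
  unfolding X_def by auto

lemma flip_in_X: "\<beta> \<in> X \<Longrightarrow> shadow_at A c \<beta> \<Longrightarrow> flip c \<beta> \<in> X"
  by (rule X_step) (auto simp: braid_step_def)

lemma X_length: "\<beta> \<in> X \<Longrightarrow> length \<beta> = length \<alpha>"
proof -
  assume "\<beta> \<in> X"
  then have "(braid_step A)\<^sup>*\<^sup>* \<alpha> \<beta>" by (simp add: X_def)
  then show ?thesis by induction (auto simp: braid_step_def)
qed

lemma shadow_at_flip: "shadow_at A c \<beta> \<Longrightarrow> shadow_at A c (flip c \<beta>)"
  by (auto simp: shadow_at_def flip_def nth_list_update intro: A_sym)

lemma flip_flip: "shadow_at A c \<beta> \<Longrightarrow> flip c (flip c \<beta>) = \<beta>"
  by (rule nth_equalityI) (auto simp: nth_flip shadow_at_flip adjacent_def shadow_at_def)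

lemma braid_step_sym: "braid_step A \<beta> \<gamma> \<Longrightarrow> braid_step A \<gamma> \<beta>"
  by (auto simp: braid_step_def intro: shadow_at_flip flip_flip[symmetric])

lemma relpowp_braid_step_sym: "(braid_step A ^^ n) \<beta> \<gamma> \<Longrightarrow> (braid_step A ^^ n) \<gamma> \<beta>"
proof (induction n arbitrary: \<gamma>)
  case (Suc n)
  then obtain \<delta> where "(braid_step A ^^ n) \<beta> \<delta>" "braid_step A \<delta> \<gamma>" by auto
  then show ?case using Suc.IH braid_step_sym relpowp_Suc_I2 by metis
qed auto

lemma X_relpowp: "\<beta> \<in> X \<Longrightarrow> (braid_step A ^^ n) \<beta> \<gamma> \<Longrightarrow> \<gamma> \<in> X"
  unfolding X_def by (metis mem_Collect_eq relpowp_imp_rtranclp rtranclp_trans)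

lemma X_connected:
  assumes "\<beta> \<in> X" "\<gamma> \<in> X"
  shows "(braid_step A)\<^sup>*\<^sup>* \<beta> \<gamma>"
proof -
  have "(braid_step A)\<^sup>*\<^sup>* \<beta> \<alpha>"
    using assms(1) relpowp_braid_step_sym unfolding X_def rtranclp_power by blast
  then show ?thesis using assms(2) by (auto simp: X_def)
qed

text \<open>
  On a shortest walk from a word with shadow \<open>i\<close> to one with shadow \<open>i + 1\<close>, in either direction
  and for any \<open>i\<close>, no move has its centre among \<open>i - 1\<close>, ..., \<open>i + 2\<close>, since that would give a
  shorter walk of the same kind. So no move crosses the cut before position \<open>i + 2\<close>, and the moves
  to the right of the cut can be carried out alone. The letters \<open>ts\<close> at \<open>i\<close> and \<open>i + 1\<close> stay in
  place along the walk, so at its end the second shadow is \<open>tst\<close>, and the moves to the right bring its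
  last letter behind the first shadow: \<open>sts\<close> becomes part of \<open>stst\<close>.
\<close>

lemma shadows_not_adjacent_on_walk:
  "(braid_step A ^^ n) \<beta> \<gamma> \<Longrightarrow> \<beta> \<in> X \<Longrightarrow> shadow_at A i \<beta> \<Longrightarrow> \<not> shadow_at A (Suc i) \<gamma>"
proof (induction n arbitrary: \<beta> \<gamma> i rule: less_induct)
  case (less n)
  show ?case
  proof
    assume sh\<gamma>: "shadow_at A (Suc i) \<gamma>"
    obtain w where w: "w 0 = \<beta>" "w n = \<gamma>" "\<And>k. k < n \<Longrightarrow> braid_step A (w k) (w (Suc k))"
      using less.prems(1) by (auto simp: relpowp_fun_conv)
    obtain c where c: "\<And>k. k < n \<Longrightarrow> shadow_at A (c k) (w k)" "\<And>k. k < n \<Longrightarrow> w (Suc k) = flip (c k) (w k)"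
      using w(3) unfolding braid_step_def by metis
    have walk: "(braid_step A ^^ (l - k)) (w k) (w l)" if "k \<le> l" "l \<le> n" for k l
      unfolding relpowp_fun_conv
      by (rule exI[of _ "\<lambda>p. w (k + p)"]) (use that w(3) in auto)
    have wX: "w k \<in> X" if "k \<le> n" for k
      using walk[of 0 k] that w(1) less.prems(2) X_relpowp by auto
    have len: "length (w k) = length \<beta>" if "k \<le> n" for k
      using X_length wX that less.prems(2) by simp
    have avoid: "c k \<noteq> i \<and> c k \<noteq> Suc i \<and> Suc (c k) \<noteq> i \<and> c k \<noteq> Suc (Suc i)" if k: "k < n" for k
    proof (intro conjI notI)
      have sh: "shadow_at A (c k) (w (Suc k))" using c shadow_at_flip k by simp
      have from_\<beta>: "(braid_step A ^^ k) \<beta> (w k)" using walk[of 0 k] k w(1) by simp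
      have to_\<gamma>: "(braid_step A ^^ (n - Suc k)) (w (Suc k)) \<gamma>" using walk[of "Suc k" n] k w(2) by simp
      have X: "w k \<in> X" "w (Suc k) \<in> X" "\<gamma> \<in> X" using wX[of k] wX[of "Suc k"] wX[of n] w(2) k by auto
      have shorter: "n - Suc k < n" using k by simp
      show False if "c k = i"
        using less.IH[OF shorter to_\<gamma>] X sh sh\<gamma> that by simp
      show False if "c k = Suc i"
        using less.IH[OF k from_\<beta>] less.prems c(1)[OF k] that by simp
      show False if "Suc (c k) = i"
        using less.IH[OF k relpowp_braid_step_sym[OF from_\<beta>]] X less.prems c(1)[OF k] that by blast
      show False if "c k = Suc (Suc i)"
        using less.IH[OF shorter relpowp_braid_step_sym[OF to_\<gamma>]] X sh sh\<gamma> that by simp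
    qed
    have "i + 2 < length \<beta>" using sh\<gamma> len[of n] w(2) by (simp add: shadow_at_def)
    \<comment> \<open>What the moves to the right of the cut, among the first k, make of the first word.\<close>
    define splice where "splice k = take (i + 2) \<beta> @ drop (i + 2) (w k)" for k
    have nth_splice: "splice k ! p = (if p < i + 2 then \<beta> ! p else w k ! p)"
      and len_splice: "length (splice k) = length \<beta>" if "k \<le> n" for k p
      using \<open>i + 2 < length \<beta>\<close> len[OF that]
      by (auto simp: splice_def nth_append intro!: arg_cong[where f = "(!) (w k)"])
    have splice: "splice k \<in> X \<and> w k ! i = \<beta> ! i \<and> w k ! Suc i = \<beta> ! Suc i" if "k \<le> n" for k
      using that
    proof (induction k)
      case 0
      then show ?case using w(1) less.prems(2) by (simp add: splice_def)
    next
      case (Suc k)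
      then have k: "k < n" "k \<le> n" and IH: "splice k \<in> X" "w k ! i = \<beta> ! i" "w k ! Suc i = \<beta> ! Suc i"
        by auto
      note sh = c(1)[OF k(1)] and flip = c(2)[OF k(1)] and av = avoid[OF k(1)]
      have "splice (Suc k) \<in> X"
      proof (cases "c k < i")
        case True
        have "splice (Suc k) = splice k"
          by (rule nth_equalityI)
            (use True k Suc.prems in \<open>auto simp: len_splice nth_splice flip nth_flip[OF sh] adjacent_def\<close>)
        then show ?thesis using IH(1) by simp
      next
        case False
        then have ge: "i + 3 \<le> c k" using av by linarith
        have sh': "shadow_at A (c k) (splice k)"
          using sh ge k len[OF k(2)] by (auto simp: shadow_at_def nth_splice len_splice)
        have "splice (Suc k) = flip (c k) (splice k)"
        proof (rule nth_equalityI)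
          show "length (splice (Suc k)) = length (flip (c k) (splice k))"
            using len_splice k Suc.prems by simp
          fix p
          have "splice (Suc k) ! p = (if p < i + 2 then \<beta> ! p else flip (c k) (w k) ! p)"
            using nth_splice[OF Suc.prems] flip by simp
          also have "\<dots> = flip (c k) (splice k) ! p"
            unfolding nth_flip[OF sh] nth_flip[OF sh'] nth_splice[OF k(2)]
            using ge by (auto simp: adjacent_def)
          finally show "splice (Suc k) ! p = flip (c k) (splice k) ! p" .
        qed
        then show ?thesis using flip_in_X[OF IH(1) sh'] by simp
      qed
      moreover have "w (Suc k) ! i = \<beta> ! i \<and> w (Suc k) ! Suc i = \<beta> ! Suc i"
        using av IH unfolding flip nth_flip[OF sh] adjacent_def by auto
      ultimately show ?case by simp
    qed
    have "splice n ! (i - 1) = \<beta> ! (i + 1)" "splice n ! i = \<beta> ! i" "splice n ! (i + 1) = \<beta> ! (i + 1)"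
      "splice n ! (i + 2) = \<beta> ! i" "length (splice n) = length \<gamma>"
      using less.prems(3) sh\<gamma> splice[of n] w(2) len[of n]
      by (auto simp: nth_splice len_splice shadow_at_def)
    then show False
      using no_xyxy[of "splice n" "i - 1"] splice[of n] less.prems(3) sh\<gamma> 
      by (auto simp: X_def shadow_at_def numeral_2_eq_2 numeral_3_eq_3)
  qed
qed

lemma centres_not_adjacent:
  assumes "c \<in> centres" "d \<in> centres"
  shows "\<not> adjacent c d"
proof -
  have "Suc i \<notin> centres" if "i \<in> centres" for i
  proof
    assume "Suc i \<in> centres"
    with that obtain \<beta> \<gamma> where *: "\<beta> \<in> X" "\<gamma> \<in> X" "shadow_at A i \<beta>" "shadow_at A (Suc i) \<gamma>"
      by (auto simp: centres_def)
    then obtain n where "(braid_step A ^^ n) \<beta> \<gamma>"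
      using X_connected unfolding rtranclp_power by blast
    then show False using shadows_not_adjacent_on_walk * by blast
  qed
  then show ?thesis using assms by (auto simp: adjacent_def)
qed

text \<open>
  Let \<open>q\<close> be next to the centre \<open>c\<close>, and follow the moves from a word with shadow \<open>c\<close>. The letter
  at \<open>c\<close> stays in the original pair, and the letter at \<open>q\<close> is the other one of the pair unless
  the centre \<open>d\<close> on the far side of \<open>q\<close> has interfered; then both the expected and the actual
  letter at \<open>q\<close> are letters of \<open>d\<close>. If such an interference persisted at the next move around
  \<open>c\<close>, these two letters together with the one at \<open>c\<close> would form a triangle.

  The hypothesis \<open>edge\<close> concerns the far side of \<open>q\<close> only, so that the pairs can be found by
  induction from the left.
\<close>

lemma side_invariant:
  assumes \<beta>: "\<beta> \<in> X" "shadow_at A c \<beta>" and cq: "adjacent c q"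
    and edge: "\<And>d x y. d \<in> centres \<Longrightarrow> adjacent q d \<Longrightarrow> d \<noteq> c \<Longrightarrow> x \<in> letters d \<Longrightarrow> y \<in> letters d \<Longrightarrow>
      x \<noteq> y \<Longrightarrow> A x y"
    and \<delta>: "\<delta> \<in> X"
  shows "\<exists>y. {\<delta> ! c, y} = {\<beta> ! c, \<beta> ! (c - 1)} \<and>
    (\<delta> ! q = y \<or> (\<exists>d\<in>centres. adjacent q d \<and> d \<noteq> c \<and> y \<in> letters d \<and> \<delta> ! q \<in> letters d))"
proof -
  have "(braid_step A)\<^sup>*\<^sup>* \<beta> \<delta>" using \<beta>(1) \<delta> by (rule X_connected)
  then show ?thesis
  proof induction
    case base
    show ?case using shadow_at_adjacentD(1)[OF \<beta>(2) cq] by auto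
  next
    case (step \<delta> \<delta>')
    have \<delta>X: "\<delta> \<in> X" using \<beta>(1) step.hyps(1) by (auto simp: X_def)
    obtain e where e: "shadow_at A e \<delta>" "\<delta>' = flip e \<delta>" using step.hyps(2) by (auto simp: braid_step_def)
    have \<delta>'X: "\<delta>' \<in> X" using \<delta>X e flip_in_X by simp
    have centre: "e \<in> centres" "c \<in> centres" using \<delta>X e(1) \<beta> centresI by blast+
    then have e_far: "\<not> adjacent c e" "e \<noteq> q" using centres_not_adjacent cq by blast+
    obtain y where y: "{\<delta> ! c, y} = {\<beta> ! c, \<beta> ! (c - 1)}"
      and q: "\<delta> ! q = y \<or> (\<exists>d\<in>centres. adjacent q d \<and> d \<noteq> c \<and> y \<in> letters d \<and> \<delta> ! q \<in> letters d)"
      using step.IH by blast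
    have "A (\<beta> ! (c - 1)) (\<beta> ! c)" using \<beta>(2) unfolding shadow_at_def by blast
    then have Ay: "A y (\<delta> ! c)" using y A_sym by (auto simp: doubleton_eq_iff)
    consider "e = c" | "e \<noteq> c" "adjacent q e" | "e \<noteq> c" "\<not> adjacent q e" by blast
    then show ?case
    proof cases
      case 1
      have A\<delta>: "A (\<delta> ! q) (\<delta> ! c)" using shadow_at_adjacentD(2) e(1) 1 cq by blast
      \<comment> \<open>Otherwise the two letters of the far centre and the letter at c form a triangle.\<close>
      have "\<delta> ! q = y"
      proof (rule ccontr)
        assume "\<delta> ! q \<noteq> y"
        then have "A (\<delta> ! q) y" using q edge by blast
        then show False using no_triangle A\<delta> Ay by blast
      qed
      then have "\<delta>' ! c = y" "\<delta>' ! q = \<delta> ! c"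
        using shadow_at_adjacentD(1)[OF e(1), of q] cq e 1 nth_flip[OF e(1)]
        by (auto simp: adjacent_def)
      then show ?thesis using y by (intro exI[of _ "\<delta> ! c"]) auto
    next
      case 2
      have qe: "adjacent e q" using 2 adjacent_sym by blast
      have "\<delta>' ! c = \<delta> ! c" using nth_flip[OF e(1)] e(2) e_far 2 adjacent_sym by auto
      moreover have "\<delta> ! q = \<delta>' ! e" "\<delta>' ! q = \<delta> ! e"
        using nth_flip[OF e(1)] e(2) qe shadow_at_adjacentD(1)[OF e(1) qe] by (auto simp: adjacent_def)
      then have "\<delta> ! q \<in> letters e" "\<delta>' ! q \<in> letters e" using letters_memI \<delta>X \<delta>'X by metis+
      moreover have "y \<in> letters e"
      proof (cases "\<delta> ! q = y")
        case False
        then obtain d where d: "adjacent q d" "d \<noteq> c" "y \<in> letters d" using q by blast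
        then have "d = e" using 2 cq by (auto simp: adjacent_def)
        then show ?thesis using d by simp
      qed (use \<open>\<delta> ! q \<in> letters e\<close> in simp)
      ultimately show ?thesis using y 2 centre by (intro exI[of _ y]) auto
    next
      case 3
      then have "\<delta>' ! c = \<delta> ! c" "\<delta>' ! q = \<delta> ! q"
        using nth_flip[OF e(1)] e(2) e_far adjacent_sym by auto
      then show ?thesis using y q by auto
    qed
  qed
qed

text \<open>
  Induction from the left: the invariant for the left neighbour of \<open>c\<close> refers only to the pair of
  a smaller centre.
\<close>

lemma letters_eq:
  assumes "\<beta> \<in> X" "shadow_at A c \<beta>"
  shows "letters c = {\<beta> ! c, \<beta> ! (c - 1)}"
  using assms
proof (induction c arbitrary: \<beta> rule: less_induct)
  case (less c)
  have c: "adjacent c (c - 1)" using less.prems(2) by (auto simp: adjacent_def shadow_at_def)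
  have "A x y" if d: "d \<in> centres" "adjacent (c - 1) d" "d \<noteq> c"
    and xy: "x \<in> letters d" "y \<in> letters d" "x \<noteq> y" for d x y
  proof -
    have "d < c" using d c by (auto simp: adjacent_def)
    obtain \<gamma> where \<gamma>: "\<gamma> \<in> X" "shadow_at A d \<gamma>" using d(1) by (auto simp: centres_def)
    then have "letters d = {\<gamma> ! d, \<gamma> ! (d - 1)}" using less.IH \<open>d < c\<close> by blast
    then show ?thesis using xy \<gamma>(2) A_sym by (auto simp: shadow_at_def)
  qed
  note inv = side_invariant[OF less.prems c this]
  show ?case
  proof
    show "letters c \<subseteq> {\<beta> ! c, \<beta> ! (c - 1)}"
      using inv by (fastforce simp: letters_def)
    have "flip c \<beta> ! c = \<beta> ! (c - 1)" using nth_flip[OF less.prems(2)] by simp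
    then show "{\<beta> ! c, \<beta> ! (c - 1)} \<subseteq> letters c"
      using letters_memI[of \<beta> c] letters_memI[of "flip c \<beta>" c] flip_in_X less.prems by auto
  qed
qed

lemma letters_adjacent:
  assumes "c \<in> centres" "x \<in> letters c" "y \<in> letters c" "x \<noteq> y"
  shows "A x y"
proof -
  obtain \<beta> where "\<beta> \<in> X" "shadow_at A c \<beta>" using assms(1) by (auto simp: centres_def)
  then show ?thesis using letters_eq[of \<beta> c] assms A_sym by (auto simp: shadow_at_def)
qed

lemma letters_other:
  assumes "c \<in> centres" "x \<in> letters c"
  obtains y where "letters c = {x, y}" "x \<noteq> y"
proof -
  obtain \<beta> where \<beta>: "\<beta> \<in> X" "shadow_at A c \<beta>" using assms(1) by (auto simp: centres_def)
  then have "\<beta> ! (c - 1) \<noteq> \<beta> ! c" using A_neq unfolding shadow_at_def by blast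
  moreover have "x = \<beta> ! c \<or> x = \<beta> ! (c - 1)" using letters_eq[OF \<beta>] assms(2) by simp
  ultimately show ?thesis
    using that[of "\<beta> ! c"] that[of "\<beta> ! (c - 1)"] letters_eq[OF \<beta>] by (metis insert_commute)
qed

text \<open>
  A word is blocked at \<open>c\<close> on the side of \<open>q\<close> if the letter at \<open>q\<close> is not the other letter
  of \<open>c\<close>. This is always the work of a neighbouring centre.
\<close>

lemma side_letter:
  assumes "c \<in> centres" "adjacent c q" "\<delta> \<in> X" "letters c = {\<delta> ! c, y}"
    and "\<delta> ! q \<noteq> y"
  obtains d where "d \<in> centres" "adjacent q d" "d \<noteq> c" "y \<in> letters d" "\<delta> ! q \<in> letters d"
proof -
  obtain \<beta> where \<beta>: "\<beta> \<in> X" "shadow_at A c \<beta>" using assms(1) by (auto simp: centres_def)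
  obtain z where z: "{\<delta> ! c, z} = {\<beta> ! c, \<beta> ! (c - 1)}"
    "\<delta> ! q = z \<or> (\<exists>d\<in>centres. adjacent q d \<and> d \<noteq> c \<and> z \<in> letters d \<and> \<delta> ! q \<in> letters d)"
    using side_invariant[OF \<beta> assms(2) _ assms(3)] letters_adjacent by blast
  have "{\<delta> ! c, z} = {\<delta> ! c, y}" using z(1) letters_eq[OF \<beta>] assms(4) by simp
  then have "z = y" by (auto simp: doubleton_eq_iff)
  then show ?thesis using z(2) assms(5) that by blast
qed

text \<open>
  If \<open>c\<close> and \<open>c + 2\<close> had the same pair \<open>{x, y}\<close>, a word with a shadow \<open>xyx\<close> around \<open>c\<close> would
  continue with \<open>y\<close>, giving \<open>xyxy\<close>, or with \<open>x\<close>, giving \<open>yxyx\<close> after the move around \<open>c\<close>.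
\<close>

lemma letters_neq:
  assumes "c \<in> centres" "d \<in> centres" "adjacent c q" "adjacent q d" "c \<noteq> d"
  shows "letters c \<noteq> letters d"
proof -
  have *: "letters c \<noteq> letters (Suc (Suc c))" if c: "c \<in> centres" "Suc (Suc c) \<in> centres" for c
  proof
    assume eq: "letters c = letters (Suc (Suc c))"
    obtain \<beta> where \<beta>: "\<beta> \<in> X" "shadow_at A c \<beta>" using c(1) by (auto simp: centres_def)
    obtain \<gamma> where "\<gamma> \<in> X" "shadow_at A (Suc (Suc c)) \<gamma>" using c(2) by (auto simp: centres_def)
    then have len: "c + 3 < length \<beta>" using X_length \<beta>(1) by (auto simp: shadow_at_def)
    have "\<beta> ! (c + 2) = \<beta> ! c \<or> \<beta> ! (c + 2) = \<beta> ! (c - 1)"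
      using letters_memI[OF \<beta>(1), of "c + 2"] eq letters_eq[OF \<beta>] by auto
    then show False
    proof
      assume "\<beta> ! (c + 2) = \<beta> ! c"
      then show False using no_xyxy[of \<beta> "c - 1"] \<beta> len 
        by (auto simp: X_def shadow_at_def numeral_2_eq_2 numeral_3_eq_3)
    next
      assume *: "\<beta> ! (c + 2) = \<beta> ! (c - 1)"
      have "flip c \<beta> \<in> X" "shadow_at A c (flip c \<beta>)" "flip c \<beta> ! (c + 2) = flip c \<beta> ! c"
        using \<beta> flip_in_X shadow_at_flip * by (auto simp: nth_flip adjacent_def)
      then show False using no_xyxy[of "flip c \<beta>" "c - 1"] len
        by (auto simp: X_def shadow_at_def numeral_2_eq_2 numeral_3_eq_3)
    qed
  qed
  have "d = Suc (Suc c) \<or> c = Suc (Suc d)" using assms by (auto simp: adjacent_def)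
  then show ?thesis using *[of c] *[of d] assms by auto
qed

section \<open>Path distance in a braid class\<close>

lemma side_letter_towards:
  assumes "c \<in> centres" "adjacent c q" "adjacent q d" "d \<noteq> c" "\<delta> \<in> X" "letters c = {\<delta> ! c, y}"
    and "\<delta> ! q \<noteq> y"
  shows "y \<in> letters d" "\<delta> ! q \<in> letters d"
proof -
  obtain e where e: "adjacent q e" "e \<noteq> c" "y \<in> letters e" "\<delta> ! q \<in> letters e"
    using side_letter[OF assms(1,2,5,6,7)] .
  have "e = d" using e(1,2) assms(2,3,4) by (auto simp: adjacent_def)
  then show "y \<in> letters d" "\<delta> ! q \<in> letters d" using e by simp_all
qed

text \<open>
  Let the pairs of \<open>c\<close> and of the centre \<open>d\<close> beyond \<open>q\<close> be \<open>{s, t}\<close> and \<open>{t, u}\<close>. The word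
  \<open>\<beta>\<close> is blocked at \<open>c\<close> only if it reads \<open>sut\<close> from \<open>c\<close> to \<open>d\<close>. Then \<open>\<gamma>\<close> has \<open>t\<close>
  at \<open>c\<close>, so it reads \<open>tsu\<close>. Thus \<open>\<beta>\<close> and \<open>\<gamma>\<close> differ at \<open>d\<close> as well, and the last conclusion
  says that \<open>\<beta>\<close> is not blocked at \<open>d\<close> on the side of \<open>q\<close>.
\<close>

lemma blocked_by_next_centre:
  assumes X: "\<beta> \<in> X" "\<gamma> \<in> X" and c: "c \<in> centres" "\<beta> ! c \<noteq> \<gamma> ! c"
    and q: "adjacent c q" "\<beta> ! q \<noteq> \<gamma> ! c"
  obtains d where "d \<in> centres" "adjacent q d" "d \<noteq> c" "\<beta> ! d \<noteq> \<gamma> ! d" "\<beta> ! q = \<gamma> ! d"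
proof -
  have Ec: "letters c = {\<beta> ! c, \<gamma> ! c}" "letters c = {\<gamma> ! c, \<beta> ! c}"
    using letters_other[OF c(1) letters_memI[OF X(1)]] letters_memI[OF X(2), of c] c(2)
    by (metis doubleton_eq_iff empty_iff insert_iff)+
  obtain d where d: "d \<in> centres" "adjacent q d" "d \<noteq> c" "\<gamma> ! c \<in> letters d" "\<beta> ! q \<in> letters d"
    using side_letter[OF c(1) q(1) X(1) Ec(1) q(2)] .
  have Ed: "letters d = {\<gamma> ! c, \<beta> ! q}"
    using letters_other[OF d(1,4)] d(5) q(2) by (metis empty_iff insert_iff)
  have neq: "letters c \<noteq> letters d" using letters_neq c(1) d q(1) by metis
  have qc: "adjacent q c" using q(1) adjacent_sym by blast
  have dq: "adjacent d q" using d(2) adjacent_sym by blast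
  have out: "\<beta> ! q \<notin> letters c" using Ec Ed neq q(2) by auto
  have \<gamma>q: "\<gamma> ! q = \<beta> ! c"
  proof (rule ccontr)
    assume "\<gamma> ! q \<noteq> \<beta> ! c"
    from side_letter_towards(1)[OF c(1) q(1) d(2,3) X(2) Ec(2) this]
    show False using Ec Ed neq c(2) by auto
  qed
  have "\<gamma> ! d = \<beta> ! q"
  proof (rule ccontr)
    assume "\<gamma> ! d \<noteq> \<beta> ! q"
    then have "\<gamma> ! d = \<gamma> ! c" using letters_memI[OF X(2), of d] unfolding Ed by blast
    then have "letters d = {\<gamma> ! d, \<beta> ! q}" using Ed by simp
    moreover have "\<gamma> ! q \<noteq> \<beta> ! q" using \<gamma>q out letters_memI[OF X(1), of c] by metis
    ultimately have "\<beta> ! q \<in> letters c"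
      by (rule side_letter_towards(1)[OF d(1) dq qc d(3)[symmetric] X(2)])
    then show False using out by simp
  qed
  moreover have "\<beta> ! d \<noteq> \<beta> ! q"
  proof
    assume "\<beta> ! d = \<beta> ! q"
    then have "letters d = {\<beta> ! d, \<gamma> ! c}" using Ed by (simp add: insert_commute)
    then have "\<beta> ! q \<in> letters c"
      using side_letter_towards(2)[OF d(1) dq qc d(3)[symmetric] X(1) _ q(2)] by blast
    then show False using out by simp
  qed
  ultimately show ?thesis using that d by metis
qed

lemma centre_bounds: "c \<in> centres \<Longrightarrow> 1 \<le> c \<and> c + 1 < length \<alpha>"
  using X_length by (auto simp: centres_def shadow_at_def)

lemma finite_centres: "finite centres"
  by (rule finite_subset[of _ "{..<length \<alpha>}"]) (use centre_bounds in fastforce)+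

definition differ :: "'a list \<Rightarrow> 'a list \<Rightarrow> nat set" where
  "differ \<beta> \<gamma> = {c \<in> centres. \<beta> ! c \<noteq> \<gamma> ! c}"

lemma finite_differ: "finite (differ \<beta> \<gamma>)"
  using finite_centres by (simp add: differ_def)

lemma letter_fixed:
  assumes "\<delta> \<in> X" "q \<notin> centres" "\<And>c. c \<in> centres \<Longrightarrow> \<not> adjacent c q"
  shows "\<delta> ! q = \<alpha> ! q"
proof -
  have "(braid_step A)\<^sup>*\<^sup>* \<alpha> \<delta>" using assms(1) by (simp add: X_def)
  then show ?thesis
  proof induction
    case (step \<delta> \<delta>')
    obtain e where e: "shadow_at A e \<delta>" "\<delta>' = flip e \<delta>" using step.hyps(2) by (auto simp: braid_step_def)
    then have "e \<in> centres" using step.hyps(1) centresI by (auto simp: X_def)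
    then show ?case using nth_flip[OF e(1)] e(2) assms step.IH by metis
  qed simp
qed

text \<open>
  Two different letters at \<open>q\<close> would both be letters of the centre \<open>d\<close> beyond \<open>q\<close>, so one of
  the two words repeats at \<open>q\<close> its letter at \<open>d\<close>. That word is blocked at \<open>d\<close> from the side of
  \<open>c\<close>, which puts both letters of \<open>d\<close> among those of \<open>c\<close>,
  contrary to \<open>letters_neq\<close>.
\<close>

lemma side_letter_determined:
  assumes X: "\<beta> \<in> X" "\<gamma> \<in> X" and c: "c \<in> centres" "adjacent c q" and agree: "differ \<beta> \<gamma> = {}"
  shows "\<beta> ! q = \<gamma> ! q"
proof (rule ccontr)
  assume neq: "\<beta> ! q \<noteq> \<gamma> ! q"
  have eq: "\<beta> ! d = \<gamma> ! d" if "d \<in> centres" for d using agree that by (auto simp: differ_def)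
  obtain y where y: "letters c = {\<beta> ! c, y}" "\<beta> ! c \<noteq> y"
    using letters_other[OF c(1) letters_memI[OF X(1)]] by metis
  then have y': "letters c = {\<gamma> ! c, y}" using eq[OF c(1)] by simp
  have beyond: "e = d" if "adjacent q e" "e \<noteq> c" "adjacent q d" "d \<noteq> c" for d e
    using that c(2) by (auto simp: adjacent_def)
  have beyond_\<beta>: "\<exists>d\<in>centres. adjacent q d \<and> d \<noteq> c \<and> y \<in> letters d \<and> \<beta> ! q \<in> letters d"
    if "\<beta> ! q \<noteq> y"
    using side_letter[OF c X(1) y(1) that] by blast
  have beyond_\<gamma>: "\<exists>d\<in>centres. adjacent q d \<and> d \<noteq> c \<and> y \<in> letters d \<and> \<gamma> ! q \<in> letters d"
    if "\<gamma> ! q \<noteq> y"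
    using side_letter[OF c X(2) y' that] by blast
  have "\<exists>d\<in>centres. adjacent q d \<and> d \<noteq> c \<and> \<beta> ! q \<in> letters d \<and> \<gamma> ! q \<in> letters d"
  proof (cases "\<beta> ! q = y")
    case True
    then have "\<gamma> ! q \<noteq> y" using neq by simp
    then show ?thesis using beyond_\<gamma> True by blast
  next
    case False
    show ?thesis
    proof (cases "\<gamma> ! q = y")
      case True
      then show ?thesis using beyond_\<beta>[OF False] by blast
    next
      case \<gamma>: False
      obtain d where "d \<in> centres" "adjacent q d" "d \<noteq> c" "\<beta> ! q \<in> letters d"
        using beyond_\<beta>[OF False] by blast
      moreover obtain d' where "adjacent q d'" "d' \<noteq> c" "\<gamma> ! q \<in> letters d'"
        using beyond_\<gamma>[OF \<gamma>] by blast
      moreover have "d' = d" using calculation beyond by blast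
      ultimately show ?thesis by blast
    qed
  qed
  then obtain d where d: "d \<in> centres" "adjacent q d" "d \<noteq> c" "\<beta> ! q \<in> letters d" "\<gamma> ! q \<in> letters d"
    by blast
  have dq: "adjacent d q" using d(2) adjacent_sym by blast
  have qc: "adjacent q c" using c(2) adjacent_sym by blast
  obtain z where z: "letters d = {\<beta> ! d, z}" "\<beta> ! d \<noteq> z"
    using letters_other[OF d(1) letters_memI[OF X(1)]] by metis
  then have z': "letters d = {\<gamma> ! d, z}" using eq[OF d(1)] by simp
  have "\<exists>\<delta>\<in>{\<beta>, \<gamma>}. \<delta> ! q = \<beta> ! d" using d(4,5) z neq by auto
  then obtain \<delta> where \<delta>: "\<delta> \<in> X" "\<delta> ! q = \<beta> ! d" "letters d = {\<delta> ! d, z}" using X z z' by auto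
  have "\<delta> ! q \<noteq> z" using \<delta> z by simp
  then have "z \<in> letters c" "\<beta> ! d \<in> letters c"
    using side_letter_towards[OF d(1) dq qc d(3)[symmetric] \<delta>(1,3)] \<delta>(2) by auto
  then have "letters c = letters d" using y z by auto
  then show False using letters_neq c d by metis
qed

lemma differ_empty:
  assumes "\<beta> \<in> X" "\<gamma> \<in> X" "differ \<beta> \<gamma> = {}"
  shows "\<beta> = \<gamma>"
proof (rule nth_equalityI)
  show "length \<beta> = length \<gamma>" using assms X_length by simp
  fix q
  consider "q \<in> centres" | c where "c \<in> centres" "adjacent c q"
    | "q \<notin> centres" "\<And>c. c \<in> centres \<Longrightarrow> \<not> adjacent c q" by blast
  then show "\<beta> ! q = \<gamma> ! q"
  proof cases
    case 1
    then show ?thesis using assms(3) by (auto simp: differ_def)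
  next
    case 2
    then show ?thesis using side_letter_determined assms by blast
  next
    case 3
    then show ?thesis using letter_fixed assms by simp
  qed
qed

text \<open>
  The leftmost centre where \<open>\<beta>\<close> and \<open>\<gamma>\<close> differ is not blocked from the left, because a blocking
  centre would be a difference further left. The rightmost difference that is not blocked from the left
  is not blocked from the right either, because the blocking centre would be such a difference further
  right. So \<open>\<beta>\<close> has a shadow there.
\<close>

lemma shadow_towards:
  assumes X: "\<beta> \<in> X" "\<gamma> \<in> X" and "\<beta> \<noteq> \<gamma>"
  obtains c where "shadow_at A c \<beta>" "c \<in> differ \<beta> \<gamma>"
proof -
  \<comment> \<open>The differences that are not blocked from the left.\<close>
  define L where "L = {c \<in> differ \<beta> \<gamma>. \<beta> ! (c - 1) = \<gamma> ! c}"
  have fin: "finite L" using finite_differ by (simp add: L_def)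
  have D: "differ \<beta> \<gamma> \<noteq> {}" using differ_empty assms by blast
  let ?c = "Min (differ \<beta> \<gamma>)"
  have "?c \<in> L"
  proof (rule ccontr)
    assume nL: "?c \<notin> L"
    have c: "?c \<in> differ \<beta> \<gamma>" using D finite_differ by simp
    then have "?c \<in> centres" "\<beta> ! ?c \<noteq> \<gamma> ! ?c" by (auto simp: differ_def)
    moreover have adj: "adjacent ?c (?c - 1)"
      using centre_bounds[OF calculation(1)] by (simp add: adjacent_def)
    moreover have "\<beta> ! (?c - 1) \<noteq> \<gamma> ! ?c" using nL c by (simp add: L_def)
    ultimately obtain d where d: "d \<in> centres" "adjacent (?c - 1) d" "d \<noteq> ?c" "\<beta> ! d \<noteq> \<gamma> ! d"
      using blocked_by_next_centre[OF X] by metis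
    then have "d \<in> differ \<beta> \<gamma>" "d < ?c" using adj by (auto simp: differ_def adjacent_def)
    then show False using Min_le[OF finite_differ, of d \<beta> \<gamma>] by simp
  qed
  then have c: "Max L \<in> L" using fin Max_in by blast
  define c where "c = Max L"
  have c: "c \<in> centres" "\<beta> ! c \<noteq> \<gamma> ! c" "\<beta> ! (c - 1) = \<gamma> ! c" "c \<in> differ \<beta> \<gamma>"
    using c unfolding c_def L_def differ_def by auto
  have "\<beta> ! (c + 1) = \<gamma> ! c"
  proof (rule ccontr)
    assume "\<beta> ! (c + 1) \<noteq> \<gamma> ! c"
    moreover have "adjacent c (c + 1)" by (simp add: adjacent_def)
    ultimately obtain d where d: "d \<in> centres" "adjacent (c + 1) d" "d \<noteq> c" "\<beta> ! d \<noteq> \<gamma> ! d"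
      "\<beta> ! (c + 1) = \<gamma> ! d"
      using blocked_by_next_centre[OF X c(1,2)] by metis
    then have "d = c + 2" by (auto simp: adjacent_def)
    then have "c + 2 \<in> L" using d by (simp add: L_def differ_def)
    then have "c + 2 \<le> c" using Max_ge[OF fin] unfolding c_def by blast
    then show False by simp
  qed
  moreover have "A (\<gamma> ! c) (\<beta> ! c)" using letters_adjacent c letters_memI X by metis
  ultimately have "shadow_at A c \<beta>"
    using c centre_bounds[OF c(1)] X_length[OF X(1)] by (simp add: shadow_at_def)
  then show ?thesis using that c by blast
qed

lemma differ_flip:
  assumes "\<beta> \<in> X" "shadow_at A c \<beta>"
  shows "differ \<beta> (flip c \<beta>) = {c}"
proof -
  have "c \<in> centres" using assms centresI by blast
  moreover have "\<beta> ! (c - 1) \<noteq> \<beta> ! c" using assms(2) A_neq by (auto simp: shadow_at_def)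
  ultimately show ?thesis
    using nth_flip[OF assms(2)] centres_not_adjacent by (auto simp: differ_def)
qed

definition signature :: "'a list \<Rightarrow> bool list" where
  "signature \<beta> = map (\<lambda>c. \<beta> ! c \<noteq> \<alpha> ! c) (sorted_list_of_set centres)"

lemma \<alpha>_in_X: "\<alpha> \<in> X"
  by (simp add: X_def)

lemma signature_nth_differs:
  assumes "\<beta> \<in> X" "\<gamma> \<in> X" "i < card centres"
  shows "signature \<beta> ! i \<noteq> signature \<gamma> ! i \<longleftrightarrow> sorted_list_of_set centres ! i \<in> differ \<beta> \<gamma>"
proof -
  let ?c = "sorted_list_of_set centres ! i"
  have len: "i < length (sorted_list_of_set centres)" using assms(3) by simp
  have c: "?c \<in> centres" using nth_mem[OF len] finite_centres by simp
  obtain y where "letters ?c = {\<alpha> ! ?c, y}"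
    using letters_other[OF c letters_memI[OF \<alpha>_in_X]] by metis
  then have mem: "\<beta> ! ?c \<in> {\<alpha> ! ?c, y}" "\<gamma> ! ?c \<in> {\<alpha> ! ?c, y}"
    using letters_memI assms by metis+
  have "(b \<noteq> a) \<noteq> (g \<noteq> a) \<longleftrightarrow> b \<noteq> g" if "b \<in> {a, y}" "g \<in> {a, y}" for a b g
    using that by auto
  from this[OF mem] show ?thesis using len c by (simp add: signature_def differ_def)
qed

lemma hamming_signature:
  assumes "\<beta> \<in> X" "\<gamma> \<in> X"
  shows "hamming (card centres) (signature \<beta>) (signature \<gamma>) = card (differ \<beta> \<gamma>)"
proof -
  let ?cs = "sorted_list_of_set centres"
  let ?I = "{i. i < card centres \<and> signature \<beta> ! i \<noteq> signature \<gamma> ! i}"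
  have I: "?I = {i. i < card centres \<and> ?cs ! i \<in> differ \<beta> \<gamma>}"
    using signature_nth_differs[OF assms] by auto
  have "inj_on ((!) ?cs) ?I" by (auto simp: inj_on_def nth_eq_iff_index_eq)
  moreover have "(!) ?cs ` ?I = differ \<beta> \<gamma>"
  proof -
    have "d \<in> (!) ?cs ` ?I" if "d \<in> differ \<beta> \<gamma>" for d
    proof -
      have "d \<in> set ?cs" using that finite_centres by (simp add: differ_def)
      then obtain i where "i < card centres" "?cs ! i = d" by (auto simp: in_set_conv_nth)
      then show ?thesis using that unfolding I by auto
    qed
    then show ?thesis unfolding I by auto
  qed
  ultimately show ?thesis unfolding hamming_def using card_image[of "(!) ?cs" ?I] by simp
qed

text \<open>
  The braid graph in terms of \<open>A\<close>; see \<open>class_graph_eq_braid_graph\<close>.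
\<close>

definition class_graph :: "'a list pair_pre_digraph" where
  "class_graph = \<lparr> pverts = X, parcs = {(\<beta>, \<gamma>). \<beta> \<in> X \<and> \<gamma> \<in> X \<and> braid_step A \<beta> \<gamma>} \<rparr>"

lemma wf_class_graph: "wf_digraph (with_proj class_graph)"
  by unfold_locales (auto simp: class_graph_def)

lemma class_graph_distance:
  assumes X: "\<beta> \<in> X" "\<gamma> \<in> X"
  shows "graph_dist class_graph \<beta> \<gamma> = ereal (real (card (differ \<beta> \<gamma>)))"
    and "\<beta> \<rightarrow>\<^sup>*\<^bsub>with_proj class_graph\<^esub> \<gamma>"
proof -
  have diag: "card (differ \<beta> \<beta>) = 0" for \<beta> by (simp add: differ_def)
  have step: "card (differ \<beta> \<gamma>) \<le> Suc (card (differ \<beta>' \<gamma>))" if arc: "(\<beta>, \<beta>') \<in> parcs class_graph" for \<beta> \<beta>' \<gamma>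
  proof -
    from arc obtain c where "\<beta> \<in> X" "shadow_at A c \<beta>" "\<beta>' = flip c \<beta>"
      by (auto simp: class_graph_def braid_step_def)
    then have c: "differ \<beta> \<beta>' = {c}" using differ_flip by blast
    have "differ \<beta> \<gamma> \<subseteq> insert c (differ \<beta>' \<gamma>)"
    proof
      fix d
      assume "d \<in> differ \<beta> \<gamma>"
      then have "d \<in> differ \<beta> \<beta>' \<or> d \<in> differ \<beta>' \<gamma>" unfolding differ_def by force
      then show "d \<in> insert c (differ \<beta>' \<gamma>)" unfolding c by blast
    qed
    then have "card (differ \<beta> \<gamma>) \<le> card (insert c (differ \<beta>' \<gamma>))"
      using finite_differ by (intro card_mono) auto
    also have "\<dots> \<le> Suc (card (differ \<beta>' \<gamma>))"
      using finite_differ by (simp add: card_insert_if)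
    finally show ?thesis .
  qed
  have approach: "\<exists>\<beta>'. (\<beta>, \<beta>') \<in> parcs class_graph \<and> card (differ \<beta>' \<gamma>) < card (differ \<beta> \<gamma>)"
    if V: "\<beta> \<in> pverts class_graph" "\<gamma> \<in> pverts class_graph" "\<beta> \<noteq> \<gamma>" for \<beta> \<gamma>
  proof -
    have X: "\<beta> \<in> X" "\<gamma> \<in> X" using V by (auto simp: class_graph_def)
    obtain c where c: "shadow_at A c \<beta>" "c \<in> differ \<beta> \<gamma>" using shadow_towards[OF X V(3)] .
    have fX: "flip c \<beta> \<in> X" using flip_in_X X c by blast
    then have "(\<beta>, flip c \<beta>) \<in> parcs class_graph"
      using X c by (auto simp: class_graph_def braid_step_def)
    moreover have "differ (flip c \<beta>) \<gamma> = differ \<beta> \<gamma> - {c}"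
    proof -
      have d: "differ \<beta> (flip c \<beta>) = {c}" using differ_flip X c by blast
      have cc: "c \<in> centres" using c by (simp add: differ_def)
      obtain y where "letters c = {\<beta> ! c, y}" 
        using letters_other[OF cc letters_memI[OF X(1)]] by metis
      then have "flip c \<beta> ! c \<in> {\<beta> ! c, y}" "\<gamma> ! c \<in> {\<beta> ! c, y}"
        using letters_memI fX X by metis+
      moreover have "flip c \<beta> ! c \<noteq> \<beta> ! c" "\<gamma> ! c \<noteq> \<beta> ! c"
        using d c(2) unfolding differ_def by force+
      ultimately have eq: "flip c \<beta> ! c = \<gamma> ! c" by (metis insert_iff singletonD)
      have same: "flip c \<beta> ! e = \<beta> ! e" if "e \<in> centres" "e \<noteq> c" for e
      proof -
        have "e \<notin> differ \<beta> (flip c \<beta>)" using d that by simp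
        then show ?thesis using that by (simp add: differ_def)
      qed
      have "e \<in> differ (flip c \<beta>) \<gamma> \<longleftrightarrow> e \<in> differ \<beta> \<gamma> - {c}" for e
        using eq same[of e] by (cases "e = c") (simp_all add: differ_def cong: conj_cong)
      then show ?thesis by blast
    qed
    then have "card (differ (flip c \<beta>) \<gamma>) < card (differ \<beta> \<gamma>)"
      using c(2) finite_differ by (metis card_Diff1_less)
    ultimately show ?thesis by blast
  qed
  have verts: "\<beta> \<in> pverts class_graph" "\<gamma> \<in> pverts class_graph"
    using X by (auto simp: class_graph_def)
  note distance = graph_dist_eqI[where \<delta> = "\<lambda>\<beta> \<gamma>. card (differ \<beta> \<gamma>)",
      OF wf_class_graph diag step approach verts]
  show "graph_dist class_graph \<beta> \<gamma> = ereal (real (card (differ \<beta> \<gamma>)))" by (rule distance(1))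
  show "\<beta> \<rightarrow>\<^sup>*\<^bsub>with_proj class_graph\<^esub> \<gamma>" by (rule distance(2))
qed

lemma isometric_embedding_signature:
  "isometric_embedding class_graph (hypercube (card centres)) signature"
proof -
  have len: "length (signature \<beta>) = card centres" for \<beta>
    by (simp add: signature_def)
  have "graph_dist (hypercube (card centres)) (signature \<beta>) (signature \<gamma>) = graph_dist class_graph \<beta> \<gamma>"
    if "\<beta> \<in> X" "\<gamma> \<in> X" for \<beta> \<gamma>
    using graph_dist_hypercube[OF len len] hamming_signature class_graph_distance(1) that by simp
  then show ?thesis
    using len by (auto simp: isometric_embedding_def hypercube_def class_graph_def)
qed

lemma partial_cube_class_graph: "partial_cube class_graph"
proof -
  interpret wf_digraph "with_proj class_graph" by (rule wf_class_graph)
  have "Digraph_Component.connected (with_proj class_graph)"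
    unfolding Digraph_Component.connected_def strongly_connected_def
    using class_graph_distance(2) reachable_mk_symmetricI \<alpha>_in_X
    by (auto simp: class_graph_def)
  then show ?thesis
    using isometric_embedding_signature by (auto simp: partial_cube_def)
qed

lemma isometric_dim_class_graph: "isometric_dim class_graph = card centres"
  unfolding isometric_dim_def
proof (rule Least_equality)
  show "\<exists>f. isometric_embedding class_graph (hypercube (card centres)) f"
    using isometric_embedding_signature by blast
  fix n
  assume "\<exists>g. isometric_embedding class_graph (hypercube n) g"
  then obtain g where g: "isometric_embedding class_graph (hypercube n) g" by blast
  show "card centres \<le> n"
  proof (rule isometric_embedding_dim_le[OF isometric_embedding_signature g])
    fix i assume i: "i < card centres"
    let ?c = "sorted_list_of_set centres ! i"
    have "?c \<in> centres"
      using i nth_mem[of i "sorted_list_of_set centres"] finite_centres by simp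
    then obtain \<beta> where \<beta>: "\<beta> \<in> X" "shadow_at A ?c \<beta>" by (auto simp: centres_def)
    have "signature \<beta> ! l \<noteq> signature (flip ?c \<beta>) ! l \<longleftrightarrow> l = i" if "l < card centres" for l
      using signature_nth_differs[OF \<beta>(1) flip_in_X[OF \<beta>] that] differ_flip[OF \<beta>] i that
      by (auto simp: nth_eq_iff_index_eq)
    then show "\<exists>u\<in>pverts class_graph. \<exists>v\<in>pverts class_graph.
        \<forall>l<card centres. signature u ! l \<noteq> signature v ! l \<longleftrightarrow> l = i"
      using \<beta> flip_in_X by (intro bexI[of _ \<beta>] bexI[of _ "flip ?c \<beta>"]) (auto simp: class_graph_def)
  qed
qed

end

section \<open>Reduced expressions\<close>

definition letter_adj :: "'a set \<Rightarrow> ('a \<Rightarrow> 'a \<Rightarrow> enat) \<Rightarrow> 'a \<Rightarrow> 'a \<Rightarrow> bool" where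
  "letter_adj S m s t \<longleftrightarrow> s \<in> S \<and> t \<in> S \<and> m s t = 3"

lemma braid_move_eq_braid_step:
  assumes "coxeter_matrix S m"
  shows "braid_move S m = braid_step (letter_adj S m)"
proof (intro ext iffI)
  fix \<beta> \<gamma>
  assume "braid_move S m \<beta> \<gamma>"
  then show "braid_step (letter_adj S m) \<beta> \<gamma>"
  proof cases
    case (1 s t u v)
    then have "shadow_at (letter_adj S m) (Suc (length u)) \<beta>" "\<gamma> = flip (Suc (length u)) \<beta>"
      by (auto simp: shadow_at_def letter_adj_def flip_def nth_append list_update_append)
    then show ?thesis by (auto simp: braid_step_def)
  qed
next
  fix \<beta> \<gamma>
  assume "braid_step (letter_adj S m) \<beta> \<gamma>"
  then obtain c where c: "shadow_at (letter_adj S m) c \<beta>" "\<gamma> = flip c \<beta>" by (auto simp: braid_step_def)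
  define u v s t where "u = take (c - 1) \<beta>" "v = drop (c + 2) \<beta>" "s = \<beta> ! (c - 1)" "t = \<beta> ! c"
  obtain d where d: "c = Suc d" using c(1) by (cases c) (auto simp: shadow_at_def)
  have "drop d \<beta> = s # t # s # v"
    using c(1) d unfolding u_v_s_t_def
    by (simp add: shadow_at_def Cons_nth_drop_Suc[symmetric] numeral_2_eq_2)
  then have \<beta>: "\<beta> = u @ [s, t, s] @ v"
    using append_take_drop_id[of d \<beta>] d by (simp add: u_v_s_t_def)
  have "length u = d" using c(1) d by (simp add: u_v_s_t_def shadow_at_def)
  then have "\<gamma> = u @ [t, s, t] @ v"
    using c(2) d \<beta> by (simp add: flip_def nth_append list_update_append)
  moreover have "s \<in> S" "t \<in> S" "m s t = 3"
    using c(1) by (auto simp: shadow_at_def letter_adj_def u_v_s_t_def)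
  ultimately show "braid_move S m \<beta> \<gamma>" using braid_move.intros \<beta> by metis
qed

definition positive_word :: "'a list \<Rightarrow> 'a signed_word" where
  "positive_word = map (\<lambda>s. (s, True))"

lemma positive_word_in_signed_words: "u \<in> lists S \<Longrightarrow> positive_word u \<in> signed_words S"
  by (auto simp: positive_word_def signed_words_def)

lemma word_value_eq_class:
  assumes "u \<in> lists S"
  shows "word_value S m u = presentation_rel S (coxeter_relators S m) `` {positive_word u}"
  using assms
proof (induction u)
  case Nil
  then show ?case
    by (simp add: word_value_def coxeter_group_def presented_group_def positive_word_def)
next
  case (Cons s u)
  have "[(s, True)] \<in> signed_words S" using Cons.hyps by (simp add: signed_words_def)
  moreover have "word_value S m (s # u)
    = coxeter_generator S m s \<otimes>\<^bsub>coxeter_group S m\<^esub> word_value S m u"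
    by (simp add: word_value_def)
  ultimately show ?case
    using Cons positive_word_in_signed_words[of u S] unfolding coxeter_generator_def coxeter_group_def
    by (simp add: presented_group_mult) (simp add: positive_word_def)
qed

lemma word_value_relator:
  assumes "u \<in> lists S" "v \<in> lists S" "s \<in> S" "t \<in> S" "m s t = enat k"
  shows "word_value S m (u @ concat (replicate k [s, t]) @ v) = word_value S m (u @ v)"
proof -
  let ?r = "concat (replicate k [s, t])"
  have r: "?r \<in> lists S" using assms(3,4) by (induction k) auto
  have "positive_word ?r = concat (replicate k [(s, True), (t, True)])"
    by (simp add: positive_word_def map_concat)
  then have "positive_word ?r \<in> coxeter_relators S m"
    using assms unfolding coxeter_relators_def by blast
  then have "presentation_eq S (coxeter_relators S m)
    (positive_word u @ positive_word ?r @ positive_word v) (positive_word u @ positive_word v)"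
    using assms(1,2) r by (intro presentation_eq.relator positive_word_in_signed_words)
  then have "presentation_eq S (coxeter_relators S m) (positive_word (u @ ?r @ v)) (positive_word (u @ v))"
    by (simp only: positive_word_def map_append)
  then have "(positive_word (u @ ?r @ v), positive_word (u @ v)) \<in> presentation_rel S (coxeter_relators S m)"
    by (simp add: presentation_rel_def)
  moreover have "u @ ?r @ v \<in> lists S" "u @ v \<in> lists S" using assms r by auto
  ultimately show ?thesis
    using equiv_class_eq[OF equiv_presentation_rel] by (simp add: word_value_eq_class del: append_in_lists_conv)
qed

lemma word_value_square:
  assumes "coxeter_matrix S m" "u \<in> lists S" "v \<in> lists S" "s \<in> S"
  shows "word_value S m (u @ [s, s] @ v) = word_value S m (u @ v)"
  using word_value_relator[of u S v s s m 1] assms by (simp add: coxeter_matrix_def one_enat_def)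

text \<open>
  Appending squares makes \<open>sts\<close> into \<open>(st)\<^sup>3 tst\<close>.
\<close>

lemma word_value_braid:
  assumes m: "coxeter_matrix S m" and uv: "u \<in> lists S" "v \<in> lists S" and st: "letter_adj S m s t"
  shows "word_value S m (u @ [s, t, s] @ v) = word_value S m (u @ [t, s, t] @ v)"
proof -
  have S: "s \<in> S" "t \<in> S" "m s t = enat 3" using st by (auto simp: letter_adj_def numeral_eq_enat)
  have "word_value S m (u @ [s, t, s] @ v) = word_value S m ((u @ [s, t, s]) @ [t, t] @ v)"
    using word_value_square[OF m, of "u @ [s, t, s]" v t] uv S by simp
  also have "\<dots> = word_value S m ((u @ [s, t, s, t]) @ [s, s] @ ([t] @ v))"
    using word_value_square[OF m, of "u @ [s, t, s, t]" "[t] @ v" s] uv S by simp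
  also have "\<dots> = word_value S m ((u @ [s, t, s, t, s]) @ [t, t] @ ([s, t] @ v))"
    using word_value_square[OF m, of "u @ [s, t, s, t, s]" "[s, t] @ v" t] uv S by simp
  also have "\<dots> = word_value S m (u @ [t, s, t] @ v)"
    using word_value_relator[of u S "[t, s, t] @ v" s t m 3] uv S by (simp add: numeral_3_eq_3)
  finally show ?thesis .
qed

lemma reduced_expression_braid_class:
  assumes m: "coxeter_matrix S m" and red: "reduced_expression S m w \<alpha>"
    and "(braid_move S m)\<^sup>*\<^sup>* \<alpha> \<beta>"
  shows "reduced_expression S m w \<beta>"
  using assms(3)
proof induction
  case base
  show ?case by (rule red)
next
  case (step \<beta> \<gamma>)
  from step.hyps(2) show ?case
  proof cases
    case (1 s t u v)
    then have "u \<in> lists S" "v \<in> lists S" "letter_adj S m s t"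
      using step.IH by (auto simp: reduced_expression_def letter_adj_def)
    from word_value_braid[OF m this] show ?thesis
      using step.IH 1 by (auto simp: reduced_expression_def)
  qed
qed

text \<open>
  \<open>stst = tstt = ts\<close> is shorter.
\<close>

lemma reduced_expression_no_xyxy:
  assumes m: "coxeter_matrix S m" and red: "reduced_expression S m w (u @ [s, t, s, t] @ v)"
  shows "\<not> letter_adj S m s t"
proof
  assume st: "letter_adj S m s t"
  have S: "u \<in> lists S" "v \<in> lists S" "s \<in> S" "t \<in> S" using red by (auto simp: reduced_expression_def)
  have "word_value S m (u @ [s, t, s, t] @ v) = word_value S m ((u @ [t, s]) @ [t, t] @ v)"
    using word_value_braid[OF m, of u "[t] @ v" s t] S st by simp
  also have "\<dots> = word_value S m (u @ [t, s] @ v)"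
    using word_value_square[OF m, of "u @ [t, s]" v t] S by simp
  finally have "word_value S m (u @ [t, s] @ v) = w" using red by (simp add: reduced_expression_def)
  moreover have "u @ [t, s] @ v \<in> lists S" using S by simp
  ultimately have "length (u @ [s, t, s, t] @ v) \<le> length (u @ [t, s] @ v)"
    using red by (simp only: reduced_expression_def)
  then show False by simp
qed

lemma letter_adj_no_triangle:
  assumes m: "coxeter_matrix S m" and \<Lambda>: "type_Lambda S m"
    and adj: "letter_adj S m x y" "letter_adj S m y z"
  shows "\<not> letter_adj S m x z"
proof
  assume xz: "letter_adj S m x z"
  have "m s s \<noteq> 3" if "s \<in> S" for s
    using m that by (simp add: coxeter_matrix_def one_enat_def numeral_eq_enat)
  then have ne: "x \<noteq> y" "y \<noteq> z" "x \<noteq> z" and S: "x \<in> S" "y \<in> S" "z \<in> S"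
    using adj xz by (auto simp: letter_adj_def)
  have zx: "m z x = 3" using m xz by (simp add: coxeter_matrix_def letter_adj_def)
  let ?p = "[(x, y), (y, z), (z, x)]"
  have "pre_digraph.cycle (with_proj (coxeter_graph S m)) ?p"
    unfolding pre_digraph.cycle_def pre_digraph.awalk_def cas_with_proj_eq awalk_verts_with_proj_eq
    using adj zx ne S by (intro exI[of _ x]) (auto simp: coxeter_graph_def letter_adj_def)
  then show False using \<Lambda> by (auto simp: type_Lambda_def)
qed

lemma braid_words_reduced_expression:
  assumes m: "coxeter_matrix S m" and \<Lambda>: "type_Lambda S m" and red: "reduced_expression S m w \<alpha>"
  shows "braid_words (letter_adj S m) \<alpha>"
proof
  show "letter_adj S m y x" if "letter_adj S m x y" for x y
    using that m by (auto simp: letter_adj_def coxeter_matrix_def)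
  show "\<not> letter_adj S m x z" if "letter_adj S m x y" "letter_adj S m y z" for x y z
    using letter_adj_no_triangle[OF m \<Lambda> that] .
  fix \<beta> i
  assume \<beta>: "(braid_step (letter_adj S m))\<^sup>*\<^sup>* \<alpha> \<beta>" and i: "i + 3 < length \<beta>"
    and adj: "letter_adj S m (\<beta> ! i) (\<beta> ! (i + 1))" and rep: "\<beta> ! (i + 2) = \<beta> ! i"
  have "reduced_expression S m w \<beta>"
    using reduced_expression_braid_class[OF m red] \<beta> braid_move_eq_braid_step[OF m] by metis
  show "\<beta> ! (i + 3) \<noteq> \<beta> ! (i + 1)"
  proof
    assume "\<beta> ! (i + 3) = \<beta> ! (i + 1)"
    then have "drop i \<beta> = \<beta> ! i # \<beta> ! (i + 1) # \<beta> ! i # \<beta> ! (i + 1) # drop (i + 4) \<beta>"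
      using i rep
      by (simp add: Cons_nth_drop_Suc[symmetric] numeral_2_eq_2 numeral_3_eq_3 eval_nat_numeral)
    then have "\<beta> = take i \<beta> @ [\<beta> ! i, \<beta> ! (i + 1), \<beta> ! i, \<beta> ! (i + 1)] @ drop (i + 4) \<beta>"
      using append_take_drop_id[of i \<beta>] by simp
    then show False
      using reduced_expression_no_xyxy[OF m] \<open>reduced_expression S m w \<beta>\<close> adj by metis
  qed
qed

section \<open>Braid graphs of reduced expressions\<close>

lemma (in braid_words) class_graph_eq_braid_graph:
  assumes "coxeter_matrix S m" "A = letter_adj S m"
  shows "class_graph = braid_graph S m \<alpha>"
  unfolding class_graph_def braid_graph_def braid_class_def X_def
    braid_move_eq_braid_step[OF assms(1)] assms(2)[symmetric] by simp

lemma (in braid_words) card_centres_eq_braid_dim: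
  assumes "coxeter_matrix S m" "A = letter_adj S m"
  shows "card centres = braid_dim S m \<alpha>"
proof -
  let ?f = "\<lambda>i :: nat. {i - 1, i, i + 1}"
  have shadows: "braid_shadows S m \<beta> = ?f ` {c. shadow_at A c \<beta>}" for \<beta>
    unfolding braid_shadows_def shadow_at_def assms(2) letter_adj_def by auto
  have "braid_class S m \<alpha> = X"
    unfolding braid_class_def X_def braid_move_eq_braid_step[OF assms(1)] assms(2)[symmetric] ..
  then have "class_braid_shadows S m \<alpha> = (\<Union>\<beta>\<in>X. ?f ` {c. shadow_at A c \<beta>})"
    by (simp only: class_braid_shadows_def shadows)
  moreover have "centres = (\<Union>\<beta>\<in>X. {c. shadow_at A c \<beta>})" by (auto simp: centres_def)
  ultimately have "class_braid_shadows S m \<alpha> = ?f ` centres" by (simp only: image_UN)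
  moreover have "inj_on ?f centres"
  proof (rule inj_onI)
    fix c d
    assume eq: "?f c = ?f d"
    have "c + 1 \<in> ?f d" unfolding eq[symmetric] by blast
    moreover have "d + 1 \<in> ?f c" unfolding eq by blast
    ultimately have "c + 1 \<le> d + 1" "d + 1 \<le> c + 1" by auto
    then show "c = d" by simp
  qed
  ultimately show ?thesis by (simp add: braid_dim_def card_image)
qed

theorem proposition6p3:
  fixes S :: "'a set" and m :: "'a \<Rightarrow> 'a \<Rightarrow> enat" and w :: "'a signed_word set" and \<alpha> :: "'a list"
  assumes "coxeter_matrix S m"
    and "type_Lambda S m"
    and "w \<in> carrier (coxeter_group S m)"
    and "reduced_expression S m w \<alpha>"
  shows "partial_cube (braid_graph S m \<alpha>)
    \<and> isometric_dim (braid_graph S m \<alpha>) = braid_dim S m \<alpha>"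
proof -
  interpret braid_words "letter_adj S m" \<alpha>
    using assms(1,2,4) by (rule braid_words_reduced_expression)
  show ?thesis
    using partial_cube_class_graph isometric_dim_class_graph
      class_graph_eq_braid_graph[OF assms(1) HOL.refl] card_centres_eq_braid_dim[OF assms(1) HOL.refl]
    by simp
qed

end
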